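(* Let $\Omega\subset\mathbb{C}^d$ be a $\mathbb{C}$-proper convex open set. If $(\Omega,d_\Omega)$ is Gromov hyperbolic, then $\partial\Omega$ contains no non-trivial holomorphic disk, i.e. there is no non-constant holomorphic map $\varphi:\Delta\to\mathbb{C}^d$ with $\varphi(\Delta)\subset\partial\Omega$.
   Context: An open convex set is $\mathbb{C}$-proper if it contains no complex affine line; for such sets the Kobayashi distance $d_\Omega$ is a complete metric. $\Delta$ is the unit disk in $\mathbb{C}$. Gromov hyperbolic: there is $\delta\ge0$ such that every geodesic triangle is $\delta$-thin. *)

theory Defs
  imports "HOL-Analysis.Analysis" "HOL-Complex_Analysis.Complex_Analysis"
begin

definition C_proper :: "(complex ^ 'n) set \<Rightarrow> bool" where
  "C_proper \<Omega> \<longleftrightarrow> \<not> (\<exists>a v. v \<noteq> 0 \<and> (\<forall>z::complex. a + z *s v \<in> \<Omega>))"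

definition holo_map :: "(complex \<Rightarrow> complex ^ 'n) \<Rightarrow> bool" where
  "holo_map f \<longleftrightarrow> (\<forall>i. (\<lambda>z. f z $ i) holomorphic_on ball 0 1)"

definition poincare_dist :: "complex \<Rightarrow> complex \<Rightarrow> real" where
  "poincare_dist z w = artanh (cmod (z - w) / cmod (1 - cnj z * w))"

definition kobayashi_dist :: "(complex ^ 'n) set \<Rightarrow> complex ^ 'n \<Rightarrow> complex ^ 'n \<Rightarrow> real" where
  "kobayashi_dist \<Omega> p q = Inf {(\<Sum>i<n. poincare_dist (a i) (b i)) | n a b f x.
      x 0 = p \<and> x n = q \<and>
      (\<forall>i<n. holo_map (f i) \<and> f i ` ball 0 1 \<subseteq> \<Omega> \<and>
              a i \<in> ball 0 1 \<and> b i \<in> ball 0 1 \<and>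
              f i (a i) = x i \<and> f i (b i) = x (Suc i))}"

definition geodesic_seg :: "('a \<Rightarrow> 'a \<Rightarrow> real) \<Rightarrow> 'a set \<Rightarrow> (real \<Rightarrow> 'a) \<Rightarrow> real \<Rightarrow> real \<Rightarrow> bool" where
  "geodesic_seg dd S \<sigma> a b \<longleftrightarrow> a \<le> b \<and> \<sigma> ` {a..b} \<subseteq> S \<and>
     (\<forall>s\<in>{a..b}. \<forall>t\<in>{a..b}. dd (\<sigma> s) (\<sigma> t) = \<bar>s - t\<bar>)"

definition near :: "('a \<Rightarrow> 'a \<Rightarrow> real) \<Rightarrow> real \<Rightarrow> 'a set \<Rightarrow> 'a set \<Rightarrow> bool" where
  "near dd \<delta> A B \<longleftrightarrow> (\<forall>p\<in>A. \<exists>q\<in>B. dd p q \<le> \<delta>)"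

definition gromov_hyperbolic :: "('a \<Rightarrow> 'a \<Rightarrow> real) \<Rightarrow> 'a set \<Rightarrow> bool" where
  "gromov_hyperbolic dd S \<longleftrightarrow> (\<exists>\<delta>\<ge>0. \<forall>\<sigma>1 a1 b1 \<sigma>2 a2 b2 \<sigma>3 a3 b3.
     geodesic_seg dd S \<sigma>1 a1 b1 \<and> geodesic_seg dd S \<sigma>2 a2 b2 \<and> geodesic_seg dd S \<sigma>3 a3 b3 \<and>
     \<sigma>1 b1 = \<sigma>2 a2 \<and> \<sigma>2 b2 = \<sigma>3 a3 \<and> \<sigma>3 b3 = \<sigma>1 a1 \<longrightarrow>
       near dd \<delta> (\<sigma>1 ` {a1..b1}) (\<sigma>2 ` {a2..b2} \<union> \<sigma>3 ` {a3..b3}) \<and>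
       near dd \<delta> (\<sigma>2 ` {a2..b2}) (\<sigma>3 ` {a3..b3} \<union> \<sigma>1 ` {a1..b1}) \<and>
       near dd \<delta> (\<sigma>3 ` {a3..b3}) (\<sigma>1 ` {a1..b1} \<union> \<sigma>2 ` {a2..b2}))"

end

theory Submission
  imports Defs "HOL-Real_Asymp.Real_Asymp"
begin

text \<open>If the boundary contains a holomorphic disk, then, by the maximum principle applied to a supporting
  functional, it contains an affine disk around some \<open>x0\<close> in a direction tangent to a supporting
  complex hyperplane. As \<open>\<Omega>\<close> contains no complex line, the disk can be extended along some real ray
  only up to an end point \<open>x0 + e\<close>. In the coordinates ``logarithm of the height above the hyperplane''
  and ``logarithm of the distance to the end point along the ray'', the points sufficiently close to
  the boundary contain quasi-isometrically embedded flat squares of arbitrary size with uniform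
  constants: upper bounds for the distance come from explicit disks, lower bounds from complex half
  spaces containing \<open>\<Omega>\<close>. This contradicts hyperbolicity, because a geodesic stays
  within logarithmic distance of every path with the same end points. Geodesics exist because closed
  Kobayashi balls are compact and points have approximate midpoints.\<close>

section \<open>Chains of disks\<close>

text \<open>With \<open>artanh\<close> as disk distance the curvature is -4, hence every factor 2 in
  \<open>exp (2 * L)\<close> and every halved logarithm. The two coordinates are not on an equal
  footing. The hyperplane at \<open>x0\<close> contains the direction \<open>e\<close>, so heights
  can be compared between any two grid points. The half space that detects the end of a row is
  chosen at a point \<open>Pt h (1 + \<eta>)\<close>, and nothing is known about its slope in the
  direction of \<open>h\<close>; it compares only points of equal height. The comparison of the two
  corner paths gets by with this: the height difference is bounded first, and one point is then
  moved to the height of the other. A second difficulty is that a row at positive height need not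
  end at \<open>r = 1\<close>. A square of side \<open>M\<close> is therefore placed so low that its
  rows end by \<open>1 + exp (- \<kappa> * M)\<close>, an excess of the size of the distance from
  the last column to \<open>r = 1\<close>; the height depends on \<open>M\<close>, the constant
  \<open>\<kappa>\<close> does not. Lower bounds must hold for chains and not only for single disks,
  so the half-plane estimate is stated as a displacement bound that composes.\<close>

lemma tanh_diff_real: "tanh (x - y :: real) = (tanh x - tanh y) / (1 - tanh x * tanh y)"
  using tanh_add[of x "- y"] by simp

lemma tanh_artanh_real:
  assumes "\<bar>x :: real\<bar> < 1"
  shows "tanh (artanh x) = x"
proof -
  have "exp (2 * artanh x) = (1 + x) / (1 - x)"
    using assms by (simp add: artanh_def)
  moreover have "tanh y = (exp (2 * y) - 1) / (exp (2 * y) + 1)" for y :: real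
  proof -
    have "tanh y = (1 - inverse (exp (2 * y))) / (1 + inverse (exp (2 * y)))"
      by (simp add: tanh_real_altdef exp_minus)
    also have "\<dots> = (exp (2 * y) - 1) / (exp (2 * y) + 1)"
      using exp_gt_zero[of "2 * y"] by (simp add: divide_simps)
    finally show ?thesis .
  qed
  ultimately have "tanh (artanh x) = ((1 + x) / (1 - x) - 1) / ((1 + x) / (1 - x) + 1)"
    by (simp only:)
  also have "\<dots> = x" using assms by (simp add: divide_simps)
  finally show ?thesis .
qed

lemma abs_tanh_less_1 [simp]: "\<bar>tanh (t::real)\<bar> < 1"
  by (metis tanh_real_abs tanh_real_lt_1)

lemma cmod_tanh_less_1: "cmod (of_real (tanh t)) < 1"
  by simp

text \<open>The real diameter, parametrized by \<open>tanh\<close>, is a unit-speed geodesic of the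
  disk, by the subtraction formula of \<open>tanh\<close>.\<close>

lemma poincare_dist_tanh:
  "poincare_dist (of_real (tanh s)) (of_real (tanh t)) = \<bar>s - t\<bar>"
proof -
  have "poincare_dist (of_real (tanh s)) (of_real (tanh t))
      = artanh (cmod (of_real (tanh s - tanh t)) / cmod (of_real (1 - tanh s * tanh t)))"
    by (simp add: poincare_dist_def)
  also have "\<dots> = artanh \<bar>tanh (s - t)\<bar>"
    by (simp only: norm_of_real tanh_diff_real abs_divide)
  also have "\<dots> = artanh (tanh \<bar>s - t\<bar>)"
    by (simp only: tanh_real_abs)
  finally show ?thesis
    by (simp only: artanh_tanh_real)
qed

lemma poincare_dist_eq_Moebius: "poincare_dist a b = artanh (cmod (Moebius_function 0 a b))"
  by (simp add: poincare_dist_def Moebius_function_simple norm_divide norm_minus_commute)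

lemma artanh_nonneg: "0 \<le> t \<Longrightarrow> t < 1 \<Longrightarrow> 0 \<le> artanh (t::real)"
  by (simp add: artanh_def)

text \<open>Normal position for a pair of points: one at 0, the other on the nonnegative real axis.
  Both the cutting of disks and the Schwarz-Pick estimate are reduced to it.\<close>

lemma holomorphic_rotated_Moebius:
  assumes "cmod a < 1" "cmod b < 1"
  obtains m where "m holomorphic_on ball 0 1" "m ` ball 0 1 \<subseteq> ball 0 1" "m 0 = a"
    "m (of_real (cmod (Moebius_function 0 a b))) = b"
proof -
  define w where "w = Moebius_function 0 a b"
  obtain u where u: "cmod u = 1" "w = u * of_real (cmod w)"
  proof (cases "w = 0")
    case False
    then show ?thesis by (intro that[of "w / of_real (cmod w)"]) (auto simp: norm_divide)
  qed (use that[of 1] in auto)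
  \<comment> \<open>\<open>Moebius_function 0 (- a)\<close> inverts
    \<open>Moebius_function 0 a\<close>, and the rotation by \<open>u\<close> turns
    \<open>cmod w\<close> into \<open>w\<close>.\<close>
  define m where "m = Moebius_function 0 (- a) \<circ> (\<lambda>z. u * z)"
  have rot: "(\<lambda>z. u * z) ` ball 0 1 \<subseteq> ball 0 1" using u by (auto simp: norm_mult)
  show ?thesis
  proof
    show "m holomorphic_on ball 0 1"
      unfolding m_def using assms rot
      by (intro holomorphic_on_compose_gen[OF _ Moebius_function_holomorphic] holomorphic_intros) auto
    show "m ` ball 0 1 \<subseteq> ball 0 1"
      using Moebius_function_norm_lt_1[of "- a"] assms u by (auto simp: m_def norm_mult)
    show "m 0 = a" by (simp add: m_def Moebius_function_of_zero)
    show "m (of_real (cmod (Moebius_function 0 a b))) = b"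
      using Moebius_function_compose[of "- a" a b] assms u(2)
      by (simp add: m_def w_def[symmetric])
  qed
qed

text \<open>Both ends sit on the real diameter in \<open>tanh\<close> coordinates, so that cutting a
  link means cutting a real interval. By \<open>disc_linkI\<close> this covers arbitrary pairs of
  points of a disk.\<close>

definition disc_link :: "(complex ^ 'n) set \<Rightarrow> complex ^ 'n \<Rightarrow> complex ^ 'n \<Rightarrow> real \<Rightarrow> bool" where
  "disc_link \<Omega> x y l \<longleftrightarrow> (\<exists>f s t. holo_map f \<and> f ` ball 0 1 \<subseteq> \<Omega> \<and>
     f (of_real (tanh s)) = x \<and> f (of_real (tanh t)) = y \<and> l = \<bar>s - t\<bar>)"

lemma holo_map_compose:
  assumes "holo_map f" "m holomorphic_on ball 0 1" "m ` ball 0 1 \<subseteq> ball 0 1"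
  shows "holo_map (\<lambda>z. f (m z))"
proof -
  have "(\<lambda>z. f z $ i) \<circ> m holomorphic_on ball 0 1" for i
    using assms by (intro holomorphic_on_compose_gen[where t = "ball 0 1"]) (auto simp: holo_map_def)
  then show ?thesis by (simp add: holo_map_def o_def)
qed

lemma disc_linkI:
  assumes "holo_map f" "f ` ball 0 1 \<subseteq> \<Omega>" "a \<in> ball 0 1" "b \<in> ball 0 1"
  shows "disc_link \<Omega> (f a) (f b) (poincare_dist a b)"
proof -
  have ab: "cmod a < 1" "cmod b < 1" using assms by auto
  obtain m where m: "m holomorphic_on ball 0 1" "m ` ball 0 1 \<subseteq> ball 0 1" "m 0 = a"
    "m (of_real (cmod (Moebius_function 0 a b))) = b"
    using holomorphic_rotated_Moebius[OF ab] .
  define r where "r = cmod (Moebius_function 0 a b)"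
  have r: "0 \<le> r" "r < 1" using Moebius_function_norm_lt_1[OF ab] by (auto simp: r_def)
  have "holo_map (\<lambda>z. f (m z))" "(\<lambda>z. f (m z)) ` ball 0 1 \<subseteq> \<Omega>"
    using holo_map_compose[OF assms(1) m(1,2)] assms(2) m(2) by auto
  moreover have "poincare_dist a b = \<bar>0 - artanh r\<bar>"
    using r by (simp add: poincare_dist_eq_Moebius r_def artanh_nonneg)
  moreover have "f (m (of_real (tanh 0))) = f a" "f (m (of_real (tanh (artanh r)))) = f b"
    using m r by (simp_all add: tanh_artanh_real r_def)
  ultimately show ?thesis unfolding disc_link_def by blast
qed

lemma disc_link_sym: "disc_link \<Omega> x y l \<Longrightarrow> disc_link \<Omega> y x l"
  unfolding disc_link_def by (metis abs_minus_commute)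

lemma disc_link_in: "disc_link \<Omega> x y l \<Longrightarrow> x \<in> \<Omega> \<and> y \<in> \<Omega> \<and> 0 \<le> l"
  unfolding disc_link_def
  by (elim exE conjE) (metis abs_ge_zero cmod_tanh_less_1 image_subset_iff mem_ball_0)

lemma disc_link_split:
  assumes "disc_link \<Omega> x y l" "0 \<le> u" "u \<le> l"
  obtains m where "disc_link \<Omega> x m u" "disc_link \<Omega> m y (l - u)"
proof -
  obtain f s t where f: "holo_map f" "f ` ball 0 1 \<subseteq> \<Omega>" "f (of_real (tanh s)) = x"
     "f (of_real (tanh t)) = y" "l = \<bar>s - t\<bar>"
    using assms(1) unfolding disc_link_def by blast
  define v where "v = (if s \<le> t then s + u else s - u)"
  have "u = \<bar>s - v\<bar>" "l - u = \<bar>v - t\<bar>" using assms f(5) by (auto simp: v_def)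
  then show ?thesis using f that[of "f (of_real (tanh v))"] unfolding disc_link_def by blast
qed

text \<open>An inductive form of the indexed chains in \<open>kobayashi_dist\<close>, with the exact
  length as an argument. \<open>Nil\<close> does not ask for \<open>p\<close> in \<Omega>, exactly
  as the case \<open>n = 0\<close> there.\<close>

inductive disc_chain :: "(complex ^ 'n) set \<Rightarrow> complex ^ 'n \<Rightarrow> complex ^ 'n \<Rightarrow> real \<Rightarrow> bool" for \<Omega> where
  Nil: "disc_chain \<Omega> p p 0"
| Cons: "disc_link \<Omega> p x l \<Longrightarrow> disc_chain \<Omega> x q L \<Longrightarrow> disc_chain \<Omega> p q (l + L)"

lemma disc_chain_link: "disc_link \<Omega> x y l \<Longrightarrow> disc_chain \<Omega> x y l"
  using disc_chain.Cons[OF _ disc_chain.Nil] by fastforce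

lemma disc_chain_nonneg: "disc_chain \<Omega> p q L \<Longrightarrow> 0 \<le> L"
  by (induction rule: disc_chain.induct) (auto dest: disc_link_in)

lemma disc_chain_append:
  "disc_chain \<Omega> p q L \<Longrightarrow> disc_chain \<Omega> q r L' \<Longrightarrow> disc_chain \<Omega> p r (L + L')"
proof (induction rule: disc_chain.induct)
  case (Cons p x l q L)
  then show ?case using disc_chain.Cons[of \<Omega> p x l r "L + L'"] by (simp add: add.assoc)
qed simp

lemma disc_chain_sym: "disc_chain \<Omega> p q L \<Longrightarrow> disc_chain \<Omega> q p L"
proof (induction rule: disc_chain.induct)
  case (Cons p x l q L)
  then show ?case
    using disc_chain_append[OF Cons.IH disc_chain_link[OF disc_link_sym]] by (metis add.commute)
qed (rule disc_chain.Nil)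

text \<open>The cut falls inside one link and is made at a point of the diameter of its disk. This
  is the source of approximate intermediate points.\<close>

lemma disc_chain_split:
  assumes "disc_chain \<Omega> p q L" "0 \<le> u" "u \<le> L"
  shows "\<exists>m. disc_chain \<Omega> p m u \<and> disc_chain \<Omega> m q (L - u)"
  using assms
proof (induction arbitrary: u rule: disc_chain.induct)
  case (Nil p)
  then show ?case using disc_chain.Nil by (intro exI[of _ p]) auto
next
  case (Cons p x l q L)
  show ?case
  proof (cases "u \<le> l")
    case True
    obtain m where m: "disc_link \<Omega> p m u" "disc_link \<Omega> m x (l - u)"
      using disc_link_split[OF Cons(1) Cons.prems(1) True] .
    then show ?thesis
      using disc_chain_link[OF m(1)] disc_chain.Cons[OF m(2) Cons(2)]
      by (intro exI[of _ m]) (simp add: algebra_simps)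
  next
    case False
    then obtain m where m: "disc_chain \<Omega> x m (u - l)" "disc_chain \<Omega> m q (L - (u - l))"
      using Cons.IH[of "u - l"] Cons.prems by auto
    then show ?thesis
      using disc_chain.Cons[OF Cons(1) m(1)] by (intro exI[of _ m]) (simp add: algebra_simps)
  qed
qed

lemma disc_chain_in: "disc_chain \<Omega> p q L \<Longrightarrow> p \<in> \<Omega> \<longleftrightarrow> q \<in> \<Omega>"
  by (induction rule: disc_chain.induct) (auto dest: disc_link_in)

lemma kobayashi_dist_eq: "kobayashi_dist \<Omega> p q = Inf {L. disc_chain \<Omega> p q L}"
proof -
  let ?ok = "\<lambda>n a b f x. \<forall>i<n. holo_map (f i) \<and> f i ` ball 0 1 \<subseteq> \<Omega> \<and>
              a i \<in> ball 0 1 \<and> b i \<in> ball 0 1 \<and> f i (a i) = x i \<and> f i (b i) = x (Suc i)"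
  have 1: "disc_chain \<Omega> (x 0) (x n) (\<Sum>i<n. poincare_dist (a i) (b i))"
    if "?ok n a b f x" for n a b f x
    using that
  proof (induction n)
    case 0
    then show ?case by (simp add: disc_chain.Nil)
  next
    case (Suc n)
    have "disc_link \<Omega> (x n) (x (Suc n)) (poincare_dist (a n) (b n))"
      using disc_linkI[of "f n" \<Omega> "a n" "b n"] Suc.prems by auto
    from disc_chain_append[OF _ disc_chain_link[OF this]] show ?case
      using Suc by simp
  qed
  have 2: "\<exists>n a b f x. L = (\<Sum>i<n. poincare_dist (a i) (b i)) \<and> x 0 = p \<and> x n = q \<and> ?ok n a b f x"
    if "disc_chain \<Omega> p q L" for L
    using that
  proof (induction rule: disc_chain.induct)
    case (Nil p)
    then show ?case by (rule_tac exI[of _ 0], rule_tac exI[of _ "\<lambda>_. 0"], rule_tac exI[of _ "\<lambda>_. 0"],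
          rule_tac exI[of _ "\<lambda>_ _. p"], rule_tac exI[of _ "\<lambda>_. p"]) simp
  next
    case (Cons p y l q L)
    obtain n a b f x where IH: "L = (\<Sum>i<n. poincare_dist (a i) (b i))" "x 0 = y" "x n = q" "?ok n a b f x"
      using Cons.IH by blast
    obtain g s t where g: "holo_map g" "g ` ball 0 1 \<subseteq> \<Omega>" "g (of_real (tanh s)) = p"
     "g (of_real (tanh t)) = y" "l = \<bar>s - t\<bar>"
      using Cons(1) unfolding disc_link_def by blast
    show ?case
    proof (intro exI conjI)
      \<comment> \<open>\<open>case_nat\<close> puts the new disk in front of the sequences and
        shifts the old ones by one.\<close>
      show "l + L = (\<Sum>i<Suc n. poincare_dist (case_nat (of_real (tanh s)) a i) (case_nat (of_real (tanh t)) b i))"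
        by (simp add: sum.lessThan_Suc_shift IH(1) g(5) poincare_dist_tanh del: sum.lessThan_Suc)
      show "?ok (Suc n) (case_nat (of_real (tanh s)) a) (case_nat (of_real (tanh t)) b) (case_nat g f) (case_nat p x)"
      proof (intro allI impI)
        fix i assume "i < Suc n"
        then show "holo_map (case_nat g f i) \<and> case_nat g f i ` ball 0 1 \<subseteq> \<Omega> \<and>
            case_nat (of_real (tanh s)) a i \<in> ball 0 1 \<and> case_nat (of_real (tanh t)) b i \<in> ball 0 1 \<and>
            case_nat g f i (case_nat (of_real (tanh s)) a i) = case_nat p x i \<and>
            case_nat g f i (case_nat (of_real (tanh t)) b i) = case_nat p x (Suc i)"
          using IH(4) g IH(2) by (cases i) simp_all
      qed
    qed (use IH in auto)
  qed
  show ?thesis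
    unfolding kobayashi_dist_def
  proof (rule arg_cong[where f = Inf], intro set_eqI iffI)
    fix L assume "L \<in> {(\<Sum>i<n. poincare_dist (a i) (b i)) | n a b f x. x 0 = p \<and> x n = q \<and> ?ok n a b f x}"
    then obtain n a b f x where "L = (\<Sum>i<n. poincare_dist (a i) (b i))" "x 0 = p" "x n = q" "?ok n a b f x"
      by (elim CollectE exE conjE) rule
    then show "L \<in> {L. disc_chain \<Omega> p q L}" using 1[of n f a b x] by simp
  next
    fix L assume "L \<in> {L. disc_chain \<Omega> p q L}"
    then have "disc_chain \<Omega> p q L" by simp
    from 2[OF this] show "L \<in> {(\<Sum>i<n. poincare_dist (a i) (b i)) | n a b f x. x 0 = p \<and> x n = q \<and> ?ok n a b f x}"
      by (rule CollectI)
  qed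
qed

lemma kobayashi_dist_le_chain: "disc_chain \<Omega> p q L \<Longrightarrow> kobayashi_dist \<Omega> p q \<le> L"
  unfolding kobayashi_dist_eq
  by (rule cInf_lower) (auto intro!: bdd_belowI[of _ 0] disc_chain_nonneg)

lemma kobayashi_dist_same [simp]: "kobayashi_dist \<Omega> p p = 0"
  unfolding kobayashi_dist_eq
  by (rule cInf_eq_minimum) (auto intro: disc_chain.Nil disc_chain_nonneg)

lemma kobayashi_dist_sym: "kobayashi_dist \<Omega> p q = kobayashi_dist \<Omega> q p"
  unfolding kobayashi_dist_eq
  by (rule arg_cong[where f = Inf]) (auto intro: disc_chain_sym)

section \<open>Upper bounds from affine disks, and the pseudometric axioms\<close>

lemma disc_link_affine:
  assumes "\<And>z. cmod z < 1 \<Longrightarrow> x + z *s v \<in> \<Omega>" "cmod t < 1"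
  shows "disc_link \<Omega> x (x + t *s v) (artanh (cmod t))"
proof -
  have "holo_map (\<lambda>z. x + z *s v)"
    by (auto simp: holo_map_def intro!: holomorphic_intros)
  from disc_linkI[OF this, of \<Omega> 0 t] show ?thesis
    using assms by (auto simp: poincare_dist_def image_subset_iff)
qed

lemma norm_vec_scale: "norm (c *s (x :: complex ^ 'n)) = cmod c * norm x"
  by (simp add: norm_vec_def L2_set_def norm_mult power_mult_distrib
      real_sqrt_mult flip: sum_distrib_left)

lemma disc_link_ball:
  assumes "ball x r \<subseteq> \<Omega>" "dist x y < r"
  shows "disc_link \<Omega> x y (artanh (dist x y / r))"
proof (cases "x = y")
  case True
  have "r > 0" using assms by (metis dist_not_less_zero linorder_not_less order.strict_trans1)
  then have "x + z *s 0 \<in> \<Omega>" for z using assms(1) by auto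
  from disc_link_affine[of x 0 \<Omega> 0, OF this] show ?thesis using True by simp
next
  case False
  define d where "d = dist x y"
  have d: "d > 0" "d < r" using False assms by (auto simp: d_def)
  have n: "norm (y - x) = d" by (simp add: d_def dist_norm norm_minus_commute)
  let ?v = "of_real (r / d) *s (y - x)" and ?t = "of_real (d / r) :: complex"
  have "x + z *s ?v \<in> \<Omega>" if "cmod z < 1" for z
  proof -
    have "norm (z *s ?v) < r" using that d 
      by (simp add: norm_vec_scale n norm_mult norm_divide del: vector_smult_assoc vector_ssub_ldistrib)
    then show ?thesis using assms(1) by (simp add: subset_iff dist_norm del: vector_smult_assoc vector_ssub_ldistrib)
  qed
  moreover have "cmod ?t = d / r" "d / r < 1" using d by (auto simp: norm_divide)
  moreover have "x + ?t *s ?v = y" 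
  proof -
    have "?t * of_real (r / d) = 1" using d by (simp flip: of_real_mult)
    then show ?thesis
      by (simp only: vector_smult_assoc) (simp only: vector_smult_lid, simp)
  qed
  ultimately show ?thesis
    using disc_link_affine[of x ?v \<Omega> ?t] by (auto simp: d_def)
qed

text \<open>The infimum over chains is informative only if chains exist. Being joined by a chain is
  an equivalence relation whose classes are open by \<open>disc_link_ball\<close>, and \<Omega> is
  connected.\<close>

lemma disc_chain_exists:
  assumes "open \<Omega>" "connected \<Omega>" "p \<in> \<Omega>" "q \<in> \<Omega>"
  shows "\<exists>L. disc_chain \<Omega> p q L"
  using assms(2-4)
proof (rule connected_equivalence_relation[where R = "\<lambda>p q. \<exists>L. disc_chain \<Omega> p q L"])
  fix a assume "a \<in> \<Omega>"
  then obtain r where r: "r > 0" "ball a r \<subseteq> \<Omega>" using assms(1) by (meson openE)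
  then have "\<forall>x\<in>ball a r. \<exists>L. disc_chain \<Omega> a x L"
    using disc_chain_link[OF disc_link_ball[OF r(2)]] by (metis mem_ball)
  then show "\<exists>T. openin (top_of_set \<Omega>) T \<and> a \<in> T \<and> (\<forall>x\<in>T. \<exists>L. disc_chain \<Omega> a x L)"
    using r by (intro exI[of _ "ball a r"]) (auto intro: open_subset)
qed (blast intro: disc_chain_sym disc_chain_append)+

lemma kobayashi_dist_approx:
  assumes "open \<Omega>" "connected \<Omega>" "p \<in> \<Omega>" "q \<in> \<Omega>" "\<epsilon> > 0"
  obtains L where "disc_chain \<Omega> p q L" "L < kobayashi_dist \<Omega> p q + \<epsilon>"
proof -
  have "{L. disc_chain \<Omega> p q L} \<noteq> {}" using disc_chain_exists[OF assms(1-4)] by auto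
  from cInf_lessD[OF this, of "kobayashi_dist \<Omega> p q + \<epsilon>"] show ?thesis
    using assms that by (auto simp: kobayashi_dist_eq)
qed

lemma kobayashi_dist_greatest:
  assumes "open \<Omega>" "connected \<Omega>" "p \<in> \<Omega>" "q \<in> \<Omega>"
    "\<And>L. disc_chain \<Omega> p q L \<Longrightarrow> B \<le> L"
  shows "B \<le> kobayashi_dist \<Omega> p q"
  unfolding kobayashi_dist_eq
  using disc_chain_exists[OF assms(1-4)] by (intro cInf_greatest) (auto intro: assms(5))

lemma kobayashi_dist_nonneg:
  assumes "open \<Omega>" "connected \<Omega>" "p \<in> \<Omega>" "q \<in> \<Omega>"
  shows "0 \<le> kobayashi_dist \<Omega> p q"
  using kobayashi_dist_greatest[OF assms disc_chain_nonneg] .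

lemma kobayashi_dist_triangle:
  assumes "open \<Omega>" "connected \<Omega>" "p \<in> \<Omega>" "q \<in> \<Omega>" "r \<in> \<Omega>"
  shows "kobayashi_dist \<Omega> p r \<le> kobayashi_dist \<Omega> p q + kobayashi_dist \<Omega> q r"
proof (rule field_le_epsilon)
  fix e :: real assume e: "e > 0"
  obtain L where L: "disc_chain \<Omega> p q L" "L < kobayashi_dist \<Omega> p q + e / 2"
    using kobayashi_dist_approx[OF assms(1-4) half_gt_zero[OF e]] .
  obtain L' where L': "disc_chain \<Omega> q r L'" "L' < kobayashi_dist \<Omega> q r + e / 2"
    using kobayashi_dist_approx[OF assms(1,2,4,5) half_gt_zero[OF e]] .
  show "kobayashi_dist \<Omega> p r \<le> kobayashi_dist \<Omega> p q + kobayashi_dist \<Omega> q r + e"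
    using kobayashi_dist_le_chain[OF disc_chain_append[OF L(1) L'(1)]] L(2) L'(2) by linarith
qed

section \<open>Half-space estimates\<close>

lemma cmod_add_cnj_power2: "(cmod (u + cnj w))\<^sup>2 = (cmod (u - w))\<^sup>2 + 4 * (Re u * Re w)"
  by (simp add: cmod_power2 power2_sum power2_diff)

text \<open>Schwarz-Pick for maps into the right half plane. A bound on the displacement,
  proportional to the height of the starting point, is preferred to a comparison of distances
  because it composes along chains.\<close>

lemma half_plane_Schwarz_Pick:
  assumes G: "G holomorphic_on ball 0 1" "\<And>z. z \<in> ball 0 1 \<Longrightarrow> Re (G z) > 0"
    and ab: "a \<in> ball 0 1" "b \<in> ball 0 1"
  shows "cmod (G b - G a) \<le> Re (G a) * (exp (2 * poincare_dist a b) - 1)"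
proof -
  have ab': "cmod a < 1" "cmod b < 1" using ab by auto
  obtain m where m: "m holomorphic_on ball 0 1" "m ` ball 0 1 \<subseteq> ball 0 1" "m 0 = a"
    "m (of_real (cmod (Moebius_function 0 a b))) = b"
    using holomorphic_rotated_Moebius[OF ab'] .
  define r where "r = cmod (Moebius_function 0 a b)"
  have r: "0 \<le> r" "r < 1" using Moebius_function_norm_lt_1[OF ab'] by (auto simp: r_def)
  define w where "w = G a"
  define H where "H = G \<circ> m"
  have H: "H holomorphic_on ball 0 1" "\<And>z. z \<in> ball 0 1 \<Longrightarrow> Re (H z) > 0"
    unfolding H_def using G m(1,2)
    by (auto intro: holomorphic_on_compose_gen simp: image_subset_iff)
  have w: "Re w > 0" "H 0 = w" "H (of_real r) = G b"
    using G(2)[OF ab(1)] m(3,4) by (auto simp: w_def H_def r_def)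
  have nz: "H z + cnj w \<noteq> 0" if "z \<in> ball 0 1" for z
    using H(2)[OF that] w(1) by (auto simp: complex_eq_iff)
  \<comment> \<open>The Cayley transform of the half plane that sends \<open>w\<close> to 0, which
    makes the Schwarz lemma at 0 applicable.\<close>
  define C where "C = (\<lambda>z. (H z - w) / (H z + cnj w))"
  have "cmod (C (of_real r)) \<le> cmod (of_real r)"
  proof (rule Schwarz_Lemma(1))
    show "C holomorphic_on ball 0 1"
      unfolding C_def using H(1) nz by (intro holomorphic_intros) auto
    show "cmod (C z) < 1" if "cmod z < 1" for z
    proof -
      have "(cmod (H z + cnj w))\<^sup>2 = (cmod (H z - w))\<^sup>2 + 4 * (Re (H z) * Re w)"
        by (rule cmod_add_cnj_power2)
      moreover have "Re (H z) * Re w > 0" using H(2)[of z] w(1) that by simp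
      ultimately have "(cmod (H z - w))\<^sup>2 < (cmod (H z + cnj w))\<^sup>2" by simp
      then have "cmod (H z - w) < cmod (H z + cnj w)"
        by (rule power_less_imp_less_base) simp
      then show ?thesis using nz[of z] that by (simp add: C_def norm_divide)
    qed
  qed (use r w in \<open>auto simp: C_def\<close>)
  then have *: "cmod (G b - w) \<le> r * cmod (G b + cnj w)"
    using nz[of "of_real r"] r w by (simp add: C_def norm_divide divide_simps)
  \<comment> \<open>Replacing \<open>G b + cnj w\<close> by \<open>G b - w\<close> costs
    \<open>2 * Re w\<close>; the Schwarz bound can then be solved for \<open>cmod (G b - w)\<close>.
    The resulting \<open>2 * r / (1 - r)\<close> equals \<open>(1 + r) / (1 - r) - 1\<close>, hence
    the exponential.\<close>
  have "cmod (G b + cnj w) \<le> cmod (G b - w) + 2 * Re w"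
  proof -
    have "cmod (G b + cnj w) = cmod ((G b - w) + of_real (2 * Re w))"
      by (rule arg_cong[where f = cmod]) (simp add: complex_eq_iff)
    also have "\<dots> \<le> cmod (G b - w) + cmod (of_real (2 * Re w))" by (rule norm_triangle_ineq)
    finally show ?thesis using w(1) by (simp only: norm_of_real)
  qed
  from mult_left_mono[OF this r(1)] * have "(1 - r) * cmod (G b - w) \<le> 2 * r * Re w"
    by (simp add: algebra_simps)
  then have "cmod (G b - w) \<le> Re w * (2 * r / (1 - r))"
    using r by (simp add: field_simps)
  also have "2 * r / (1 - r) = exp (2 * poincare_dist a b) - 1"
    using r by (simp add: poincare_dist_eq_Moebius r_def[symmetric] artanh_def field_simps)
  finally show ?thesis by (simp add: w_def)
qed

text \<open>The complex-linear functional with real part \<open>inner \<beta>\<close>. Separation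
  theorems yield real functionals, the Schwarz lemma needs holomorphic ones.\<close>

definition clin :: "complex ^ 'n \<Rightarrow> complex ^ 'n \<Rightarrow> complex" where
  "clin \<beta> z = (\<Sum>i\<in>UNIV. cnj (\<beta> $ i) * z $ i)"

lemma Re_clin [simp]: "Re (clin \<beta> z) = inner \<beta> z"
  by (simp add: clin_def inner_vec_def inner_complex_def)

lemma clin_diff: "clin \<beta> (x - y) = clin \<beta> x - clin \<beta> y"
  by (simp add: clin_def algebra_simps sum_subtractf)

lemma clin_scale: "clin \<beta> (c *s x) = c * clin \<beta> x"
  by (simp add: clin_def sum_distrib_left mult.left_commute)

lemma scaleR_eq_scale: "c *\<^sub>R (x :: complex ^ 'n) = of_real c *s x"
  by (simp add: vec_eq_iff scaleR_conv_of_real[where 'a = complex])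

lemma inner_scale: "inner \<beta> (c *s x) = Re (c * clin \<beta> x)"
  by (metis Re_clin clin_scale)

lemma clin_eq_0I:
  assumes "\<And>c. inner \<beta> (c *s v) = 0"
  shows "clin \<beta> v = 0"
  using assms[of 1] assms[of "\<i>"] by (simp only: inner_scale) (simp add: complex_eq_iff)

lemma continuous_on_clin [continuous_intros]:
  "continuous_on S f \<Longrightarrow> continuous_on S (\<lambda>x. clin \<beta> (f x))"
  unfolding clin_def by (intro continuous_intros)

lemma clin_holomorphic:
  "holo_map f \<Longrightarrow> (\<lambda>z. clin \<beta> (f z)) holomorphic_on ball 0 1"
  unfolding clin_def holo_map_def by (intro holomorphic_intros) auto

lemma disc_link_half_space:
  assumes "\<And>z. z \<in> \<Omega> \<Longrightarrow> inner \<beta> z < c" "disc_link \<Omega> p q l"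
  shows "cmod (clin \<beta> q - clin \<beta> p) \<le> (c - inner \<beta> p) * (exp (2 * l) - 1)"
proof -
  obtain f s t where f: "holo_map f" "f ` ball 0 1 \<subseteq> \<Omega>" "f (of_real (tanh s)) = p"
     "f (of_real (tanh t)) = q" "l = \<bar>s - t\<bar>"
    using assms(2) unfolding disc_link_def by blast
  define G where "G = (\<lambda>z. of_real c - clin \<beta> (f z))"
  have "cmod (G (of_real (tanh t)) - G (of_real (tanh s)))
      \<le> Re (G (of_real (tanh s))) * (exp (2 * poincare_dist (of_real (tanh s)) (of_real (tanh t))) - 1)"
  proof (rule half_plane_Schwarz_Pick)
    show "G holomorphic_on ball 0 1"
      unfolding G_def by (intro holomorphic_intros clin_holomorphic f)
    show "Re (G z) > 0" if "z \<in> ball 0 1" for z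
      using assms(1)[of "f z"] f(2) that by (auto simp: G_def image_subset_iff)
  qed auto
  then show ?thesis
    using f by (simp add: G_def poincare_dist_tanh norm_minus_commute)
qed

text \<open>The height at \<open>x\<close> is at most \<open>P * exp (2 * l)\<close>, so the bounds
  telescope: \<open>P * (exp (2 * l) - 1) + P * exp (2 * l) * (exp (2 * L) - 1) = P * (exp (2 * (l +
  L)) - 1)\<close>.\<close>

lemma disc_chain_half_space:
  assumes "\<And>z. z \<in> \<Omega> \<Longrightarrow> inner \<beta> z < c" "disc_chain \<Omega> p q L"
  shows "cmod (clin \<beta> q - clin \<beta> p) \<le> (c - inner \<beta> p) * (exp (2 * L) - 1)"
  using assms(2)
proof (induction rule: disc_chain.induct)
  case (Cons p x l q L)
  define P X where "P = c - inner \<beta> p" and "X = c - inner \<beta> x"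
  have 1: "cmod (clin \<beta> x - clin \<beta> p) \<le> P * (exp (2 * l) - 1)"
    using disc_link_half_space[OF assms(1) Cons(1)] by (simp add: P_def)
  have "X \<le> P + cmod (clin \<beta> x - clin \<beta> p)"
    using abs_Re_le_cmod[of "clin \<beta> x - clin \<beta> p"] by (simp add: P_def X_def)
  then have "X \<le> P * exp (2 * l)" using 1 by (simp add: algebra_simps)
  moreover have "0 \<le> exp (2 * L) - 1" using disc_chain_nonneg[OF Cons(2)] by simp
  ultimately have "X * (exp (2 * L) - 1) \<le> P * exp (2 * l) * (exp (2 * L) - 1)"
    by (rule mult_right_mono)
  then have "cmod (clin \<beta> x - clin \<beta> p) + cmod (clin \<beta> q - clin \<beta> x) \<le> P * (exp (2 * (l + L)) - 1)"
    using 1 Cons.IH by (simp add: X_def[symmetric] distrib_left exp_add algebra_simps)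
  then show ?case
    using norm_triangle_ineq[of "clin \<beta> x - clin \<beta> p" "clin \<beta> q - clin \<beta> x"] by (simp add: P_def)
qed simp

lemma ln_le_iff_exp: "0 < x \<Longrightarrow> ln x \<le> y \<longleftrightarrow> x \<le> exp (y::real)"
  by (metis exp_le_cancel_iff exp_ln)

lemma kobayashi_dist_half_space:
  assumes "open \<Omega>" "connected \<Omega>" "p \<in> \<Omega>" "q \<in> \<Omega>" "\<And>z. z \<in> \<Omega> \<Longrightarrow> inner \<beta> z < c"
  shows "cmod (clin \<beta> q - clin \<beta> p) \<le> (c - inner \<beta> p) * (exp (2 * kobayashi_dist \<Omega> p q) - 1)"
proof -
  define P where "P = c - inner \<beta> p"
  have P: "P > 0" using assms by (simp add: P_def)
  let ?t = "1 + cmod (clin \<beta> q - clin \<beta> p) / P"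
  have t: "?t > 0" using P by (intro add_pos_nonneg) auto
  \<comment> \<open>The chain estimate is solved for \<open>L\<close> so that it passes to the
    infimum, and then solved back.\<close>
  have "ln ?t / 2 \<le> kobayashi_dist \<Omega> p q"
  proof (rule kobayashi_dist_greatest[OF assms(1-4)])
    fix L assume "disc_chain \<Omega> p q L"
    then have "?t \<le> exp (2 * L)"
      using disc_chain_half_space[OF assms(5)] P by (simp add: P_def field_simps)
    then show "ln ?t / 2 \<le> L" using t by (simp add: ln_le_iff_exp mult.commute)
  qed
  then have "?t \<le> exp (2 * kobayashi_dist \<Omega> p q)"
    using t by (simp flip: ln_le_iff_exp)
  then show ?thesis using P by (simp add: P_def field_simps)
qed

text \<open>The real part of the displacement is the change of height; hence the distance to a
  supporting hyperplane grows at most by the factor \<open>exp (2 * d)\<close> over Kobayashi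
  distance \<open>d\<close>.\<close>

lemma kobayashi_dist_ln_half_space:
  assumes "open \<Omega>" "connected \<Omega>" "p \<in> \<Omega>" "q \<in> \<Omega>" "\<And>z. z \<in> \<Omega> \<Longrightarrow> inner \<beta> z < c"
  shows "ln ((c - inner \<beta> q) / (c - inner \<beta> p)) / 2 \<le> kobayashi_dist \<Omega> p q"
proof -
  have pos: "c - inner \<beta> p > 0" "c - inner \<beta> q > 0" using assms by auto
  have "inner \<beta> p - inner \<beta> q \<le> cmod (clin \<beta> q - clin \<beta> p)"
    using abs_Re_le_cmod[of "clin \<beta> q - clin \<beta> p"] by simp
  also note kobayashi_dist_half_space[OF assms]
  finally have "c - inner \<beta> q \<le> (c - inner \<beta> p) * exp (2 * kobayashi_dist \<Omega> p q)"
    by (simp add: algebra_simps)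
  then have "(c - inner \<beta> q) / (c - inner \<beta> p) \<le> exp (2 * kobayashi_dist \<Omega> p q)"
    using pos by (simp add: field_simps)
  then have "ln ((c - inner \<beta> q) / (c - inner \<beta> p)) \<le> 2 * kobayashi_dist \<Omega> p q"
    using pos by (simp add: ln_le_iff_exp)
  then show ?thesis by simp
qed

text \<open>Separation gives only a weak inequality. It becomes strict because in an open set a
  point can still be moved a little towards the hyperplane.\<close>

lemma supporting_functional:
  fixes \<Omega> :: "'a::euclidean_space set"
  assumes "open \<Omega>" "convex \<Omega>" "y \<notin> \<Omega>"
  obtains \<beta> where "\<And>z. z \<in> \<Omega> \<Longrightarrow> inner \<beta> z < inner \<beta> y"
proof (cases "\<Omega> = {}")
  case False
  have "y \<notin> rel_interior \<Omega>" using assms by (simp add: rel_interior_open)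
  obtain a b where ab: "a \<noteq> 0" "\<forall>x\<in>{y}. inner a x \<le> b" "\<forall>x\<in>\<Omega>. inner a x \<ge> b"
    using separating_hyperplane_sets[of "{y}" \<Omega>] assms False by auto
  have "inner (- a) z < inner (- a) y" if z: "z \<in> \<Omega>" for z
  proof -
    obtain r where r: "r > 0" "ball z r \<subseteq> \<Omega>" using assms(1) z by (meson openE)
    let ?z = "z - (r / 2 / norm a) *\<^sub>R a"
    have "?z \<in> \<Omega>" using r ab(1) by (auto intro!: subsetD[OF r(2)] simp: dist_norm)
    then have "inner a z - (r / 2 / norm a) * inner a a \<ge> inner a y"
      using ab by (force simp: inner_diff_right)
    moreover have "(r / 2 / norm a) * inner a a > 0" using r ab(1) by auto
    ultimately show ?thesis by simp
  qed
  then show ?thesis using that by blast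
qed (use that in auto)

section \<open>Existence of Kobayashi geodesics\<close>

locale C_proper_convex =
  fixes \<Omega> :: "(complex ^ 'n) set"
  assumes open_Omega: "open \<Omega>" and convex_Omega: "convex \<Omega>" and C_proper_Omega: "C_proper \<Omega>"
begin

abbreviation d :: "complex ^ 'n \<Rightarrow> complex ^ 'n \<Rightarrow> real" where "d \<equiv> kobayashi_dist \<Omega>"

lemma connected_Omega: "connected \<Omega>" by (rule convex_connected[OF convex_Omega])

lemmas d_nonneg = kobayashi_dist_nonneg[OF open_Omega connected_Omega]
  and d_triangle = kobayashi_dist_triangle[OF open_Omega connected_Omega]
  and d_half_space = kobayashi_dist_half_space[OF open_Omega connected_Omega]
  and d_ln_half_space = kobayashi_dist_ln_half_space[OF open_Omega connected_Omega]

section \<open>Continuity and separation of the Kobayashi distance, compactness of its balls\<close>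

lemma tendsto_d_0:
  assumes "w \<in> \<Omega>"
  shows "((\<lambda>z. d w z) \<longlongrightarrow> 0) (at w within \<Omega>)"
proof -
  obtain r where r: "r > 0" "ball w r \<subseteq> \<Omega>" using open_Omega assms by (meson openE)
  have ev: "\<forall>\<^sub>F z in at w within \<Omega>. dist w z < r"
    using r(1) by (auto simp: eventually_at dist_commute intro: exI[of _ r])
  have "((\<lambda>z. artanh (dist w z / r)) \<longlongrightarrow> artanh (dist w w / r)) (at w within \<Omega>)"
    using r(1) by (intro tendsto_intros) auto
  then have lim: "((\<lambda>z. artanh (dist w z / r)) \<longlongrightarrow> 0) (at w within \<Omega>)" by simp
  show ?thesis
  proof (rule tendsto_sandwich[OF _ _ tendsto_const lim])
    show "\<forall>\<^sub>F z in at w within \<Omega>. 0 \<le> d w z"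
      using d_nonneg[OF assms] by (auto simp: eventually_at intro: exI[of _ 1])
    show "\<forall>\<^sub>F z in at w within \<Omega>. d w z \<le> artanh (dist w z / r)"
      using ev by eventually_elim
        (rule kobayashi_dist_le_chain[OF disc_chain_link[OF disc_link_ball[OF r(2)]]])
  qed
qed

lemma continuous_on_d:
  assumes "p \<in> \<Omega>"
  shows "continuous_on \<Omega> (\<lambda>z. d p z)"
  unfolding continuous_on_def
proof
  fix w assume w: "w \<in> \<Omega>"
  have "((\<lambda>z. d p z - d p w) \<longlongrightarrow> 0) (at w within \<Omega>)"
  proof (rule Lim_null_comparison[OF _ tendsto_d_0[OF w]])
    show "\<forall>\<^sub>F z in at w within \<Omega>. norm (d p z - d p w) \<le> d w z"
      unfolding eventually_at
    proof (intro exI[of _ 1] conjI ballI impI)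
      fix z assume z: "z \<in> \<Omega>"
      show "norm (d p z - d p w) \<le> d w z"
        using d_triangle[OF assms w z] d_triangle[OF assms z w] kobayashi_dist_sym[of \<Omega> z w]
        by (simp add: abs_le_iff)
    qed simp
  qed
  then show "((\<lambda>z. d p z) \<longlongrightarrow> d p w) (at w within \<Omega>)" by (rule LIM_zero_cancel)
qed

text \<open>By C-properness the complex line through \<open>p\<close> in direction \<open>v\<close>
  leaves \<Omega>. A functional that separates an exit point from \<Omega> cannot be constant on
  this line, so its half space controls displacements along \<open>v\<close>.\<close>

lemma bounding_functional:
  assumes p: "p \<in> \<Omega>" and v: "v \<noteq> 0"
  obtains \<beta> c where "\<And>z. z \<in> \<Omega> \<Longrightarrow> inner \<beta> z < c" "clin \<beta> v \<noteq> 0"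
proof -
  obtain \<omega> where \<omega>: "p + \<omega> *s v \<notin> \<Omega>" using C_proper_Omega v unfolding C_proper_def by blast
  obtain \<beta> where \<beta>: "\<And>z. z \<in> \<Omega> \<Longrightarrow> inner \<beta> z < inner \<beta> (p + \<omega> *s v)"
    using supporting_functional[OF open_Omega convex_Omega \<omega>] by blast
  have "clin \<beta> v \<noteq> 0"
  proof
    assume "clin \<beta> v = 0"
    then have "inner \<beta> (p + \<omega> *s v) = inner \<beta> p"
      by (simp only: inner_right_distrib inner_scale mult_zero_right zero_complex.sel add_0_right)
    then show False using \<beta>[OF p] by simp
  qed
  then show ?thesis using \<beta> that by blast
qed

lemma d_eq_0D:
  assumes p: "p \<in> \<Omega>" and q: "q \<in> \<Omega>" and 0: "d p q = 0"
  shows "q = p"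
proof (rule ccontr)
  assume "q \<noteq> p"
  then obtain \<beta> c where \<beta>: "\<And>z. z \<in> \<Omega> \<Longrightarrow> inner \<beta> z < c" "clin \<beta> (q - p) \<noteq> 0"
    using bounding_functional[OF p, of "q - p"] by auto
  then show False using d_half_space[OF p q \<beta>(1)] 0 by (simp add: clin_diff)
qed

text \<open>For an unbounded sequence the normalized displacements accumulate at a unit vector
  \<open>v\<close>. The half space belonging to \<open>v\<close> bounds
  \<open>clin \<beta> (z n - p)\<close> by a constant; dividing by the growing norms gives
  \<open>clin \<beta> v = 0\<close>, a contradiction.\<close>

lemma bounded_d_ball:
  assumes p: "p \<in> \<Omega>"
  shows "bounded {z \<in> \<Omega>. d p z \<le> R}"
proof (rule ccontr)
  assume "\<not> bounded {z \<in> \<Omega>. d p z \<le> R}"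
  then have "\<exists>z. z \<in> \<Omega> \<and> d p z \<le> R \<and> norm (z - p) > real n + 1" for n
    unfolding bounded_any_center[of _ p]
    by (metis (mono_tags, lifting) dist_norm dist_commute linorder_not_le mem_Collect_eq)
  then obtain z where z: "\<And>n. z n \<in> \<Omega>" "\<And>n. d p (z n) \<le> R" "\<And>n. norm (z n - p) > real n + 1"
    by metis
  define u where "u n = (1 / norm (z n - p)) *\<^sub>R (z n - p)" for n
  have pos: "norm (z n - p) > 0" for n using z(3)[of n] by linarith
  have "norm (u n) = 1" for n using pos[of n] by (simp add: u_def)
  then have "\<forall>n. u n \<in> sphere 0 1" by simp
  then obtain v r where v: "v \<in> sphere 0 1" "strict_mono r" "(u \<circ> r) \<longlonglongrightarrow> v"
    using compact_sphere[of "0 :: complex ^ 'n" 1] unfolding compact_def by blast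
  have "v \<noteq> 0" using v(1) by auto
  then obtain \<beta> c where \<beta>: "\<And>z. z \<in> \<Omega> \<Longrightarrow> inner \<beta> z < c" "clin \<beta> v \<noteq> 0"
    using bounding_functional[OF p] by blast
  define B where "B = (c - inner \<beta> p) * (exp (2 * R) - 1)"
  have pos2: "c - inner \<beta> p > 0" using \<beta>(1)[OF p] by simp
  have "cmod (clin \<beta> (u n)) \<le> B / (real n + 1)" for n
  proof -
    have "cmod (clin \<beta> (z n - p)) \<le> (c - inner \<beta> p) * (exp (2 * d p (z n)) - 1)"
      using d_half_space[OF p z(1) \<beta>(1)] by (simp add: clin_diff)
    also have "\<dots> \<le> B"
      unfolding B_def using pos2 z(2)[of n] by (intro mult_left_mono) auto
    finally have 1: "cmod (clin \<beta> (z n - p)) \<le> B" .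
    have "cmod (clin \<beta> (u n)) = cmod (clin \<beta> (z n - p)) / norm (z n - p)"
      unfolding u_def scaleR_eq_scale clin_scale by (simp add: norm_mult norm_divide)
    also have "\<dots> \<le> B / (real n + 1)"
      using 1 z(3)[of n] by (intro frac_le) (auto intro: order_trans[OF norm_ge_zero])
    finally show ?thesis .
  qed
  then have "cmod ((clin \<beta> \<circ> (u \<circ> r)) n) \<le> B / (real (r n) + 1)" for n by simp
  moreover have "(\<lambda>n. B / (real n + 1)) \<longlonglongrightarrow> 0"
    using tendsto_mult[OF tendsto_const[of B] LIMSEQ_inverse_real_of_nat]
    by (simp add: divide_inverse add.commute)
  then have "(\<lambda>n. B / (real (r n) + 1)) \<longlonglongrightarrow> 0"
    using LIMSEQ_subseq_LIMSEQ[OF _ v(2)] by (simp add: o_def)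
  ultimately have "(clin \<beta> \<circ> (u \<circ> r)) \<longlonglongrightarrow> 0"
    by (intro Lim_null_comparison[of "clin \<beta> \<circ> (u \<circ> r)"]) auto
  moreover have "(clin \<beta> \<circ> (u \<circ> r)) \<longlonglongrightarrow> clin \<beta> v"
    using v(3) continuous_on_clin[OF continuous_on_id, of UNIV \<beta>]
    by (intro continuous_imp_tendsto) (auto simp: continuous_on_eq_continuous_at)
  ultimately show False using \<beta>(2) LIMSEQ_unique by blast
qed

lemma compact_d_ball:
  assumes p: "p \<in> \<Omega>"
  shows "compact {z \<in> \<Omega>. d p z \<le> R}"
  unfolding compact_eq_bounded_closed
proof
  show "closed {z \<in> \<Omega>. d p z \<le> R}"
    unfolding closed_sequential_limits
  proof (intro allI impI, elim conjE)
    fix z l assume "\<forall>n. z n \<in> {z \<in> \<Omega>. d p z \<le> R}" and lim: "z \<longlonglongrightarrow> l"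
    then have z: "\<And>n. z n \<in> \<Omega>" "\<And>n. d p (z n) \<le> R" by auto
    have l: "l \<in> \<Omega>"
    proof (rule ccontr)
      assume "l \<notin> \<Omega>"
      then obtain \<beta> where \<beta>: "\<And>z. z \<in> \<Omega> \<Longrightarrow> inner \<beta> z < inner \<beta> l"
        using supporting_functional[OF open_Omega convex_Omega] by blast
      \<comment> \<open>The estimate is run from \<open>z n\<close> to \<open>p\<close>, since its
        factor is the height of the starting point. This height tends to 0, which would put
        \<open>p\<close> on the supporting hyperplane at \<open>l\<close>.\<close>
      have "cmod (clin \<beta> p - clin \<beta> (z n)) \<le> (inner \<beta> l - inner \<beta> (z n)) * (exp (2 * R) - 1)" for n
      proof -
        have "cmod (clin \<beta> p - clin \<beta> (z n))
            \<le> (inner \<beta> l - inner \<beta> (z n)) * (exp (2 * d (z n) p) - 1)"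
          by (rule d_half_space[OF z(1) p \<beta>])
        also have "\<dots> \<le> (inner \<beta> l - inner \<beta> (z n)) * (exp (2 * R) - 1)"
          using \<beta>[OF z(1)[of n]] z(2)[of n] kobayashi_dist_sym[of \<Omega> p "z n"]
          by (intro mult_left_mono) auto
        finally show ?thesis .
      qed
      moreover have "(\<lambda>n. (inner \<beta> l - inner \<beta> (z n)) * (exp (2 * R) - 1))
          \<longlonglongrightarrow> (inner \<beta> l - inner \<beta> l) * (exp (2 * R) - 1)"
        by (intro tendsto_intros lim)
      then have "(\<lambda>n. (inner \<beta> l - inner \<beta> (z n)) * (exp (2 * R) - 1)) \<longlonglongrightarrow> 0" by simp
      ultimately have "(\<lambda>n. clin \<beta> p - clin \<beta> (z n)) \<longlonglongrightarrow> 0"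
        by (intro Lim_null_comparison[of "\<lambda>n. clin \<beta> p - clin \<beta> (z n)"]) auto
      then have "(\<lambda>n. Re (clin \<beta> p - clin \<beta> (z n))) \<longlonglongrightarrow> Re 0" by (rule tendsto_Re)
      moreover have "(\<lambda>n. Re (clin \<beta> p - clin \<beta> (z n))) \<longlonglongrightarrow> inner \<beta> p - inner \<beta> l"
        using lim by (auto intro!: tendsto_intros)
      ultimately have "inner \<beta> p - inner \<beta> l = Re 0" using LIMSEQ_unique by blast
      then show False using \<beta>[OF p] by simp
    qed
    have "(\<lambda>n. d p (z n)) \<longlonglongrightarrow> d p l"
      using continuous_on_tendsto_compose[OF continuous_on_d[OF p] lim l] z(1) by auto
    then have "d p l \<le> R" using z(2) by (intro LIMSEQ_le_const2) auto
    then show "l \<in> {z \<in> \<Omega>. d p z \<le> R}" using l by simp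
  qed
qed (rule bounded_d_ball[OF p])

text \<open>Cutting almost optimal chains gives points that miss the two required distances by at
  most any given positive amount. Compactness turns them into one point that does not exceed either,
  and the triangle inequality then forces equality.\<close>

lemma d_between:
  assumes p: "p \<in> \<Omega>" and q: "q \<in> \<Omega>" and t: "0 \<le> t" "t \<le> d p q"
  obtains m where "m \<in> \<Omega>" "d p m = t" "d m q = d p q - t"
proof -
  define K where "K = {z \<in> \<Omega>. d p z \<le> d p q}"
  define F where "F z = max (d p z - t) (d q z - (d p q - t))" for z
  have "compact K" unfolding K_def by (rule compact_d_ball[OF p])
  moreover have "K \<noteq> {}" using q by (auto simp: K_def)
  moreover have "continuous_on K F"
    unfolding F_def
    by (intro continuous_intros continuous_on_subset[OF continuous_on_d[OF p]]
        continuous_on_subset[OF continuous_on_d[OF q]]) (auto simp: K_def)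
  ultimately obtain m where m: "m \<in> K" "\<And>z. z \<in> K \<Longrightarrow> F m \<le> F z"
    using continuous_attains_inf[of K F] by blast
  have "F m \<le> 0"
  proof (rule field_le_epsilon)
    fix e :: real assume e: "e > 0"
    obtain L where L: "disc_chain \<Omega> p q L" "L < d p q + e"
      using kobayashi_dist_approx[OF open_Omega connected_Omega p q e] .
    then have "t \<le> L" using kobayashi_dist_le_chain[OF L(1)] t by simp
    then obtain y where y: "disc_chain \<Omega> p y t" "disc_chain \<Omega> y q (L - t)"
      using disc_chain_split[OF L(1) t(1)] by blast
    note le = kobayashi_dist_le_chain[OF y(1)] kobayashi_dist_le_chain[OF y(2)]
    have "y \<in> K" using disc_chain_in[OF y(1)] p le(1) t by (auto simp: K_def)
    moreover have "F y \<le> e" using le L(2) e by (simp add: F_def kobayashi_dist_sym[of \<Omega> q y])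
    ultimately show "F m \<le> 0 + e" using m(2)[of y] by simp
  qed
  moreover have mO: "m \<in> \<Omega>" using m(1) by (simp add: K_def)
  ultimately show ?thesis
    using that[of m] d_triangle[OF p mO q] kobayashi_dist_sym[of \<Omega> q m] by (simp add: F_def)
qed

text \<open>Graphs of isometric maps from subsets of \<open>[0, d p q]\<close>, partially ordered by inclusion; a maximal one is
  a geodesic.\<close>

definition partial_geodesic :: "complex ^ 'n \<Rightarrow> complex ^ 'n \<Rightarrow> (real \<times> (complex ^ 'n)) set \<Rightarrow> bool" where
  "partial_geodesic p q P \<longleftrightarrow> P \<subseteq> {0..d p q} \<times> \<Omega> \<and> (0, p) \<in> P \<and> (d p q, q) \<in> P \<and>
     (\<forall>(s, x) \<in> P. \<forall>(t, y) \<in> P. d x y = \<bar>s - t\<bar>)"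

text \<open>Only the neighbours \<open>a\<close> and \<open>b\<close> of \<open>t\<close> among the
  finitely many parameters matter. A point placed correctly between \<open>x\<close> and
  \<open>y\<close> has the right distance to every other point: the nearer neighbour gives the upper
  bound, the other one the lower bound.\<close>

lemma partial_geodesic_extend_finite:
  assumes P: "partial_geodesic p q P" and p: "p \<in> \<Omega>" and q: "q \<in> \<Omega>" and t: "0 \<le> t" "t \<le> d p q"
    and N: "finite N" "N \<subseteq> P"
  shows "\<exists>m\<in>\<Omega>. \<forall>(s, x)\<in>insert (0, p) N. d m x = \<bar>s - t\<bar>"
proof -
  \<comment> \<open>The two end points guarantee that there are parameters on both sides of
    \<open>t\<close>, so \<open>Max\<close> and \<open>Min\<close> are taken over nonempty
    sets.\<close>
  define N' where "N' = insert (0, p) (insert (d p q, q) N)"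
  have N': "finite N'" "N' \<subseteq> P" using N P by (auto simp: N'_def partial_geodesic_def)
  define a b where "a = Max {s \<in> fst ` N'. s \<le> t}" and "b = Min {s \<in> fst ` N'. t \<le> s}"
  have fin: "finite {s \<in> fst ` N'. s \<le> t}" "finite {s \<in> fst ` N'. t \<le> s}" using N'(1) by auto
  have "0 \<in> {s \<in> fst ` N'. s \<le> t}" "d p q \<in> {s \<in> fst ` N'. t \<le> s}"
    using t by (force simp: N'_def)+
  then have "a \<in> {s \<in> fst ` N'. s \<le> t}" "b \<in> {s \<in> fst ` N'. t \<le> s}"
    unfolding a_def b_def using Max_in[OF fin(1)] Min_in[OF fin(2)] by blast+
  then obtain x y where xy: "(a, x) \<in> N'" "(b, y) \<in> N'" and ab: "a \<le> t" "t \<le> b" by auto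
  have sep: "s \<le> a \<or> b \<le> s" if "(s, z) \<in> N'" for s z
  proof (cases "s \<le> t")
    case True
    then show ?thesis unfolding a_def using that fin(1) by (intro disjI1 Max_ge) force+
  next
    case False
    then show ?thesis unfolding b_def using that fin(2) by (intro disjI2 Min_le) force+
  qed
  have iso: "d z w = \<bar>s - r\<bar>" "z \<in> \<Omega>" if "(s, z) \<in> N'" "(r, w) \<in> N'" for s z r w
    using that N'(2) P unfolding partial_geodesic_def by blast+
  have xyO: "x \<in> \<Omega>" "y \<in> \<Omega>" "d x y = b - a" using iso xy ab by auto
  then obtain m where m: "m \<in> \<Omega>" "d x m = t - a" "d m y = b - t"
    using d_between[of x y "t - a"] ab by auto
  have "d m z = \<bar>s - t\<bar>" if "(s, z) \<in> N'" for s z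
  proof -
    have z: "z \<in> \<Omega>" using iso that by blast
    have dz: "d x z = \<bar>a - s\<bar>" "d y z = \<bar>b - s\<bar>" using iso that xy by blast+
    have tri: "d m z \<le> d x m + d x z" "d m z \<le> d m y + d y z"
      "d x z \<le> d x m + d m z" "d y z \<le> d m y + d m z"
      using d_triangle m(1) xyO z kobayashi_dist_sym by metis+
    show ?thesis using sep[OF that] tri dz m ab by auto
  qed
  then have "\<forall>(s, z)\<in>insert (0, p) N. d m z = \<bar>s - t\<bar>" unfolding N'_def by blast
  then show ?thesis using m(1) by (intro bexI[of _ m]) (auto simp: N'_def t)
qed

text \<open>Compactness of balls (finite intersection property) passes from finitely many points to all of \<open>P\<close>.\<close>

lemma partial_geodesic_extend:
  assumes P: "partial_geodesic p q P" and p: "p \<in> \<Omega>" and q: "q \<in> \<Omega>" and t: "0 \<le> t" "t \<le> d p q"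
  obtains m where "m \<in> \<Omega>" "\<And>s x. (s, x) \<in> P \<Longrightarrow> d m x = \<bar>s - t\<bar>"
proof -
  define K where "K = {z \<in> \<Omega>. d p z \<le> d p q}"
  have K: "compact K" unfolding K_def by (rule compact_d_ball[OF p])
  define C where "C = (\<lambda>(s, x). {z \<in> K. d x z = \<bar>s - t\<bar>})"
  have PO: "x \<in> \<Omega>" if "(s, x) \<in> P" for s x using that P by (auto simp: partial_geodesic_def)
  have "K \<inter> \<Inter> (C ` P) \<noteq> {}"
  proof (rule compact_imp_fip[OF K])
    fix T assume "T \<in> C ` P"
    then obtain s x where T: "(s, x) \<in> P" "T = {z \<in> K. d x z = \<bar>s - t\<bar>}" by (auto simp: C_def)
    have "closedin (top_of_set K) (K \<inter> (\<lambda>z. d x z) -` {\<bar>s - t\<bar>})"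
      by (intro continuous_closedin_preimage continuous_on_subset[OF continuous_on_d[OF PO[OF T(1)]]])
        (auto simp: K_def)
    moreover have "K \<inter> (\<lambda>z. d x z) -` {\<bar>s - t\<bar>} = T" using T by auto
    ultimately show "closed T" using K by (metis closedin_closed_trans compact_imp_closed)
  next
    fix F assume "finite F" "F \<subseteq> C ` P"
    then obtain N where N: "N \<subseteq> P" "finite N" "F = C ` N" by (meson finite_subset_image)
    obtain m where m: "m \<in> \<Omega>" "\<forall>(s, x)\<in>insert (0, p) N. d m x = \<bar>s - t\<bar>"
      using partial_geodesic_extend_finite[OF P p q t N(2,1)] by blast
    have "d p m = t" using m(2) t by (simp add: kobayashi_dist_sym[of \<Omega> p m])
    then have "m \<in> K" using m(1) t by (simp add: K_def)
    moreover have "m \<in> C sx" if "sx \<in> N" for sx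
      using that m(2) \<open>m \<in> K\<close> kobayashi_dist_sym[of \<Omega> _ m] by (cases sx) (auto simp: C_def)
    ultimately show "K \<inter> \<Inter> F \<noteq> {}" using N(3) by auto
  qed
  then obtain m where "m \<in> K" "\<forall>sx\<in>P. m \<in> C sx" by auto
  then show ?thesis
    using that[of m] kobayashi_dist_sym[of \<Omega> _ m] by (fastforce simp: K_def C_def)
qed

lemma geodesic_exists:
  assumes p: "p \<in> \<Omega>" and q: "q \<in> \<Omega>"
  obtains \<sigma> where "geodesic_seg d \<Omega> \<sigma> 0 (d p q)" "\<sigma> 0 = p" "\<sigma> (d p q) = q"
proof -
  have L: "0 \<le> d p q" using d_nonneg p q by blast
  have base: "partial_geodesic p q {(0, p), (d p q, q)}"
    using L p q by (auto simp: partial_geodesic_def kobayashi_dist_sym[of \<Omega> q p])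
  have "\<exists>M\<in>Collect (partial_geodesic p q). \<forall>X\<in>Collect (partial_geodesic p q). M \<subseteq> X \<longrightarrow> X = M"
  proof (rule subset_Zorn_nonempty)
    fix \<C> assume ne: "\<C> \<noteq> {}" and ch: "subset.chain (Collect (partial_geodesic p q)) \<C>"
    then have c: "\<And>X. X \<in> \<C> \<Longrightarrow> partial_geodesic p q X"
      "\<And>X Y. X \<in> \<C> \<Longrightarrow> Y \<in> \<C> \<Longrightarrow> X \<subseteq> Y \<or> Y \<subseteq> X"
      by (auto simp: subset_chain_def)
    have "d x y = \<bar>s - t\<bar>" if xy: "(s, x) \<in> X" "X \<in> \<C>" "(t, y) \<in> Y" "Y \<in> \<C>" for s x t y X Y
    proof -
      obtain Z where "partial_geodesic p q Z" "(s, x) \<in> Z" "(t, y) \<in> Z"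
        using c(1)[OF xy(2)] c(1)[OF xy(4)] c(2)[OF xy(2,4)] xy(1,3) by blast
      then show ?thesis by (auto simp: partial_geodesic_def)
    qed
    then have "\<forall>(s, x)\<in>\<Union>\<C>. \<forall>(t, y)\<in>\<Union>\<C>. d x y = \<bar>s - t\<bar>" by fast
    moreover have "\<Union>\<C> \<subseteq> {0..d p q} \<times> \<Omega>" "(0, p) \<in> \<Union>\<C>" "(d p q, q) \<in> \<Union>\<C>"
      using c(1) ne unfolding partial_geodesic_def by blast+
    ultimately show "\<Union>\<C> \<in> Collect (partial_geodesic p q)"
      unfolding partial_geodesic_def by (intro CollectI conjI)
  qed (use base in auto)
  then obtain M where M: "partial_geodesic p q M" "\<And>X. partial_geodesic p q X \<Longrightarrow> M \<subseteq> X \<Longrightarrow> X = M"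
    by auto
  have total: "\<exists>x. (t, x) \<in> M" if t: "0 \<le> t" "t \<le> d p q" for t
  proof -
    obtain m where m: "m \<in> \<Omega>" "\<And>s x. (s, x) \<in> M \<Longrightarrow> d m x = \<bar>s - t\<bar>"
      using partial_geodesic_extend[OF M(1) p q t] by blast
    have m': "d x m = \<bar>s - t\<bar>" if "(s, x) \<in> M" for s x
      using m(2)[OF that] by (simp add: kobayashi_dist_sym[of \<Omega> x m])
    have "partial_geodesic p q (insert (t, m) M)"
      using M(1) m m' t by (auto simp: partial_geodesic_def)
    from M(2)[OF this] show ?thesis by blast
  qed
  \<comment> \<open>If \<open>d p q = 0\<close>, the first branch also decides the value at
    \<open>d p q\<close>; then \<open>q = p\<close> by \<open>d_eq_0D\<close>.\<close>
  define \<sigma> where "\<sigma> t = (if t = 0 then p else if t = d p q then q else SOME x. (t, x) \<in> M)" for t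
  have \<sigma>: "(t, \<sigma> t) \<in> M" if "t \<in> {0..d p q}" for t
    using M(1) total[of t] that someI_ex[of "\<lambda>x. (t, x) \<in> M"]
    by (auto simp: \<sigma>_def partial_geodesic_def)
  have iso: "d (\<sigma> s) (\<sigma> t) = \<bar>s - t\<bar>" "\<sigma> s \<in> \<Omega>" if "s \<in> {0..d p q}" "t \<in> {0..d p q}" for s t
    using \<sigma>[OF that(1)] \<sigma>[OF that(2)] M(1) unfolding partial_geodesic_def by blast+
  show ?thesis
  proof (rule that[of \<sigma>])
    show "geodesic_seg d \<Omega> \<sigma> 0 (d p q)" using L iso by (auto simp: geodesic_seg_def)
  qed (use d_eq_0D[OF p q] in \<open>auto simp: \<sigma>_def\<close>)
qed

end

section \<open>Spaces with thin geodesic triangles\<close>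

text \<open>Keeping only the image makes a side of a triangle independent of its orientation and
  parametrization.\<close>

definition geodesic_set :: "('a \<Rightarrow> 'a \<Rightarrow> real) \<Rightarrow> 'a set \<Rightarrow> 'a \<Rightarrow> 'a \<Rightarrow> 'a set \<Rightarrow> bool" where
  "geodesic_set dd S x y A \<longleftrightarrow>
     (\<exists>\<sigma> a b. geodesic_seg dd S \<sigma> a b \<and> \<sigma> a = x \<and> \<sigma> b = y \<and> A = \<sigma> ` {a..b})"

lemma geodesic_set_sym:
  assumes "geodesic_set dd S x y A"
  shows "geodesic_set dd S y x A"
proof -
  obtain \<sigma> a b where s: "geodesic_seg dd S \<sigma> a b" "\<sigma> a = x" "\<sigma> b = y" "A = \<sigma> ` {a..b}"
    using assms by (auto simp: geodesic_set_def)
  have im: "(\<lambda>t. \<sigma> (- t)) ` {-b..-a} = \<sigma> ` {a..b}"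
    by (simp flip: image_image)
  have "geodesic_seg dd S (\<lambda>t. \<sigma> (- t)) (-b) (-a)"
    using s(1) im by (auto simp: geodesic_seg_def)
  then show ?thesis
    unfolding geodesic_set_def using s im by (metis minus_minus)
qed

lemma geodesic_set_between:
  assumes "geodesic_set dd S x y A" "m \<in> A"
  shows "dd x m + dd m y = dd x y" "dd x m \<ge> 0" "dd m y \<ge> 0" "m \<in> S"
  using assms by (force simp: geodesic_set_def geodesic_seg_def)+

lemma geodesic_set_midpoint:
  assumes "geodesic_set dd S x y A"
  obtains m where "m \<in> A" "dd x m = dd x y / 2" "dd m y = dd x y / 2"
proof -
  obtain \<sigma> a b where s: "geodesic_seg dd S \<sigma> a b" "\<sigma> a = x" "\<sigma> b = y" "A = \<sigma> ` {a..b}"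
    using assms by (auto simp: geodesic_set_def)
  let ?m = "\<sigma> ((a+b)/2)"
  have *: "a \<le> b" "(a+b)/2 \<in> {a..b}" and
    d: "\<And>s t. s \<in> {a..b} \<Longrightarrow> t \<in> {a..b} \<Longrightarrow> dd (\<sigma> s) (\<sigma> t) = \<bar>s - t\<bar>"
    using s(1) by (auto simp: geodesic_seg_def)
  have "dd x ?m = (b - a)/2" "dd ?m y = (b - a)/2" "dd x y = b - a"
    using d[of a "(a+b)/2"] d[of "(a+b)/2" b] d[of a b] * s by (auto simp: field_simps)
  then show ?thesis
    using that[of ?m] * s by auto
qed

text \<open>The two lower bounds mirror what half spaces yield: differences in \<open>i\<close> are
  seen for arbitrary \<open>j\<close> and \<open>j'\<close>, differences in \<open>j\<close> only
  for equal \<open>i\<close> and up to an additive loss.\<close>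

definition square_grid ::
  "('a \<Rightarrow> 'a \<Rightarrow> real) \<Rightarrow> 'a set \<Rightarrow> real \<Rightarrow> nat \<Rightarrow> (nat \<Rightarrow> nat \<Rightarrow> 'a) \<Rightarrow> bool" where
  "square_grid dd S \<kappa> M G \<longleftrightarrow>
     (\<forall>i\<le>M. \<forall>j\<le>M. G i j \<in> S) \<and>
     (\<forall>i<M. \<forall>j\<le>M. dd (G i j) (G (Suc i) j) \<le> 1) \<and>
     (\<forall>i\<le>M. \<forall>j<M. dd (G i j) (G i (Suc j)) \<le> 1) \<and>
     (\<forall>i\<le>M. \<forall>j\<le>M. \<forall>i'\<le>M. \<forall>j'\<le>M. dd (G i j) (G i' j') \<ge> \<kappa> * \<bar>real i - real i'\<bar>) \<and>
     (\<forall>i\<le>M. \<forall>j\<le>M. \<forall>j'\<le>M. dd (G i j) (G i j') \<ge> \<kappa> * \<bar>real j - real j'\<bar> - 1)"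

lemma square_gridD:
  assumes "square_grid dd S \<kappa> M G"
  shows "i \<le> M \<Longrightarrow> j \<le> M \<Longrightarrow> G i j \<in> S"
    "i < M \<Longrightarrow> j \<le> M \<Longrightarrow> dd (G i j) (G (Suc i) j) \<le> 1"
    "i \<le> M \<Longrightarrow> j < M \<Longrightarrow> dd (G i j) (G i (Suc j)) \<le> 1"
    "i \<le> M \<Longrightarrow> j \<le> M \<Longrightarrow> i' \<le> M \<Longrightarrow> j' \<le> M \<Longrightarrow>
        dd (G i j) (G i' j') \<ge> \<kappa> * \<bar>real i - real i'\<bar>"
    "i \<le> M \<Longrightarrow> j \<le> M \<Longrightarrow> j' \<le> M \<Longrightarrow> dd (G i j) (G i j') \<ge> \<kappa> * \<bar>real j - real j'\<bar> - 1"
  using assms by (simp_all add: square_grid_def)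

locale thin_geodesic_space =
  fixes dd :: "'a \<Rightarrow> 'a \<Rightarrow> real" and S :: "'a set" and \<delta> :: real
  assumes dd_sym: "\<And>x y. x \<in> S \<Longrightarrow> y \<in> S \<Longrightarrow> dd x y = dd y x"
    and dd_triangle: "\<And>x y z. x \<in> S \<Longrightarrow> y \<in> S \<Longrightarrow> z \<in> S \<Longrightarrow> dd x z \<le> dd x y + dd y z"
    and dd_refl: "\<And>x. x \<in> S \<Longrightarrow> dd x x = 0"
    and geodesic_exists: "\<And>x y. x \<in> S \<Longrightarrow> y \<in> S \<Longrightarrow> \<exists>A. geodesic_set dd S x y A"
    and delta_nonneg: "0 \<le> \<delta>"
    and thin: "\<And>x y z A B C. \<lbrakk>geodesic_set dd S x y A; geodesic_set dd S y z B; geodesic_set dd S z x C\<rbrakk>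
                 \<Longrightarrow> near dd \<delta> A (B \<union> C)"
begin

text \<open>Bridson--Haefliger, III.H.1.6: bisect the chain and use one thin triangle per bisection.\<close>

lemma geodesic_near_chain:
  assumes "\<And>i. i \<in> {a..b} \<Longrightarrow> x i \<in> S"
    and "\<And>i. a \<le> i \<Longrightarrow> i < b \<Longrightarrow> dd (x i) (x (Suc i)) \<le> 1"
    and "a \<le> b" "b - a \<le> 2 ^ k"
    and "geodesic_set dd S (x a) (x b) A" "m \<in> A"
  shows "\<exists>i\<in>{a..b}. dd m (x i) \<le> real k * \<delta> + 1"
  using assms
proof (induction k arbitrary: a b A m)
  case 0
  then have "b = a \<or> b = Suc a" by auto
  moreover have "dd (x a) (x a) = 0"
    using 0 by (intro dd_refl) auto
  ultimately have "dd (x a) (x b) \<le> 1"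
    using 0 by auto
  moreover note geodesic_set_between[OF 0(5,6)]
  moreover have "dd m (x a) = dd (x a) m"
    using 0 geodesic_set_between(4)[OF 0(5,6)] by (intro dd_sym) auto
  ultimately show ?case using 0 by (intro bexI[of _ a]) auto
next
  case (Suc k)
  \<comment> \<open>Even with rounding, both halves have at most \<open>2 ^ k\<close> steps.\<close>
  define c where "c = (a + b) div 2"
  have c: "a \<le> c" "c \<le> b" "c - a \<le> 2 ^ k" "b - c \<le> 2 ^ k"
    using Suc.prems(3,4) by (auto simp: c_def)
  have S: "x a \<in> S" "x b \<in> S" "x c \<in> S"
    using Suc.prems(1) c by auto
  obtain B where B: "geodesic_set dd S (x c) (x b) B" using geodesic_exists S by blast
  obtain C where C: "geodesic_set dd S (x a) (x c) C" using geodesic_exists S by blast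
  have "near dd \<delta> A (B \<union> C)"
    using thin Suc.prems(5) B C geodesic_set_sym by metis
  then obtain q where q: "q \<in> B \<union> C" "dd m q \<le> \<delta>"
    using Suc.prems(6) by (auto simp: near_def)
  have "\<exists>i\<in>{a..b}. dd q (x i) \<le> real k * \<delta> + 1"
  proof (cases "q \<in> B")
    case True
    have "\<exists>i\<in>{c..b}. dd q (x i) \<le> real k * \<delta> + 1"
      by (rule Suc.IH[OF _ _ c(2,4) B True]) (use Suc.prems c in auto)
    then show ?thesis using c by auto
  next
    case False
    have "\<exists>i\<in>{a..c}. dd q (x i) \<le> real k * \<delta> + 1"
      by (rule Suc.IH[OF _ _ c(1,3) C]) (use Suc.prems c q False in auto)
    then show ?thesis using c by auto
  qed
  then obtain i where i: "i \<in> {a..b}" "dd q (x i) \<le> real k * \<delta> + 1" by auto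
  have "q \<in> S" using q(1) geodesic_set_between(4)[OF B] geodesic_set_between(4)[OF C] by auto
  then have "dd m (x i) \<le> dd m q + dd q (x i)"
    using Suc.prems(1) i geodesic_set_between(4)[OF Suc.prems(5,6)] by (intro dd_triangle) auto
  then show ?case using i q by (intro bexI[of _ i]) (auto simp: algebra_simps)
qed

lemma chain_dist_le:
  assumes "\<And>i. i \<in> {a..b} \<Longrightarrow> x i \<in> S"
    and "\<And>i. a \<le> i \<Longrightarrow> i < b \<Longrightarrow> dd (x i) (x (Suc i)) \<le> 1"
    and "a \<le> b"
  shows "dd (x a) (x b) \<le> real (b - a)"
  using assms(3,1,2)
proof (induction b rule: dec_induct)
  case base
  then show ?case using dd_refl[of "x a"] by auto
next
  case (step n)
  have "dd (x a) (x (Suc n)) \<le> dd (x a) (x n) + dd (x n) (x (Suc n))"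
    using step by (intro dd_triangle) auto
  moreover have "dd (x a) (x n) \<le> real (n - a)"
    using step by auto
  ultimately show ?case using step(1,2) step(5)[of n] by (auto simp: of_nat_diff)
qed

text \<open>A geodesic joining opposite corners of a large quasi-isometrically embedded square would
  stay logarithmically close to both of the boundary paths between these corners, but these two paths
  are far from each other away from their endpoints.\<close>

lemma no_square_grids:
  assumes \<kappa>: "\<kappa> > 0"
    and grid: "\<And>M. \<exists>G. square_grid dd S \<kappa> M G"
  shows False
proof -
  \<comment> \<open>The side \<open>2 ^ k\<close> outgrows the nearness constant, which is linear in
    \<open>k\<close>. A corner path has \<open>2 * 2 ^ k\<close> steps, hence \<open>k + 1\<close>.
    Divided by \<open>\<kappa>\<close>, the inequality becomes
    \<open>\<kappa> * M > 2 * Q + 2 * R + 1\<close> below.\<close>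
  have "\<exists>k::nat. \<kappa>^2 * 2 ^ k > (4 + 2 * \<kappa>) * (real (k + 1) * \<delta> + 1) + \<kappa>"
  proof -
    have "((\<lambda>k::nat. ((4 + 2 * \<kappa>) * (real (k + 1) * \<delta> + 1) + \<kappa>) / 2 ^ k) \<longlongrightarrow> 0) at_top"
      by real_asymp
    moreover have "\<kappa>^2 > 0" using \<kappa> by simp
    ultimately have "eventually (\<lambda>k::nat. ((4 + 2 * \<kappa>) * (real (k + 1) * \<delta> + 1) + \<kappa>) / 2 ^ k < \<kappa>^2) at_top"
      by (rule order_tendstoD)
    then obtain k :: nat where "((4 + 2 * \<kappa>) * (real (k + 1) * \<delta> + 1) + \<kappa>) / 2 ^ k < \<kappa>^2"
      using eventually_happens by fastforce
    then show ?thesis by (intro exI[of _ k]) (simp add: field_simps)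
  qed
  then obtain k :: nat where k: "\<kappa>^2 * 2 ^ k > (4 + 2 * \<kappa>) * (real (k + 1) * \<delta> + 1) + \<kappa>" by blast
  define M :: nat where "M = 2 ^ k"
  define R where "R = real (k + 1) * \<delta> + 1"
  have R1: "R \<ge> 1" using delta_nonneg by (simp add: R_def)
  \<comment> \<open>\<open>Q\<close> bounds the difference of the \<open>i\<close>-coordinates of
    two grid points that both lie within \<open>R\<close> of \<open>m\<close>.\<close>
  define Q where "Q = 2 * R / \<kappa>"
  have Q: "\<kappa> * Q = 2 * R" "Q > 0" using \<kappa> R1 by (auto simp: Q_def)
  have "\<kappa> * (\<kappa> * M) > 4 * R + 2 * \<kappa> * R + \<kappa>"
    using k unfolding R_def[symmetric] M_def by (simp add: power2_eq_square algebra_simps)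
  also have "4 * R = \<kappa> * (2 * Q)" using Q by (simp add: algebra_simps)
  finally have "\<kappa> * (\<kappa> * M) > \<kappa> * (2 * Q + 2 * R + 1)"
    by (simp add: algebra_simps)
  then have big: "\<kappa> * M > 2 * Q + 2 * R + 1" using \<kappa> by (simp only: mult_less_cancel_left_pos)
  obtain G where G0: "square_grid dd S \<kappa> M G" using grid by blast
  note G = square_gridD[OF G0]
  have horiz: "dd (G i j) (G i' j) \<le> real (i' - i)" if "i \<le> i'" "i' \<le> M" "j \<le> M" for i i' j
    using that by (intro chain_dist_le[of i i' "\<lambda>i. G i j"]) (auto intro: G)
  define p q where "p = G 0 0" and "q = G M M"
  have S: "p \<in> S" "q \<in> S" by (auto simp: p_def q_def intro: G)
  obtain A where A: "geodesic_set dd S p q A" using geodesic_exists S by blast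
  obtain m where m: "m \<in> A" "dd p m = dd p q / 2" "dd m q = dd p q / 2"
    using geodesic_set_midpoint[OF A] .
  have mS: "m \<in> S" using geodesic_set_between(4)[OF A m(1)] .
  have pq: "dd p q \<ge> \<kappa> * M" using G(4)[of 0 0 M M] by (simp add: p_def q_def)
  \<comment> \<open>As a midpoint, \<open>m\<close> has distance at least
    \<open>\<kappa> * M / 2 > Q + R\<close> from both corners.\<close>
  have far: "dd p x > Q" "dd x q > Q" if "x \<in> S" "dd m x \<le> R" for x
    using dd_triangle[of p x m] dd_triangle[of m x q] dd_sym[of m x] that mS S m pq big by auto
  have path: "\<exists>i\<in>{0..2*M}. dd m (x i) \<le> R"
    if "\<And>i. i \<le> 2 * M \<Longrightarrow> x i \<in> S" "\<And>i. i < 2 * M \<Longrightarrow> dd (x i) (x (Suc i)) \<le> 1"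
      "x 0 = p" "x (2*M) = q" for x
    unfolding R_def using that A m(1) by (intro geodesic_near_chain) (auto simp: M_def)
  \<comment> \<open>With truncated subtraction this path runs along \<open>j = 0\<close> up to
    \<open>i = M\<close> and then along \<open>i = M\<close>; the second path below takes the other
    two sides.\<close>
  have "\<exists>i\<in>{0..2*M}. dd m (G (min i M) (i - M)) \<le> R"
  proof (rule path)
    show "G (min i M) (i - M) \<in> S" if "i \<le> 2 * M" for i using that by (intro G(1)) auto
    show "dd (G (min i M) (i - M)) (G (min (Suc i) M) (Suc i - M)) \<le> 1" if "i < 2 * M" for i
      using G(2)[of i 0] G(3)[of M "i - M"] that by (cases "i < M") (auto simp: Suc_diff_le)
  qed (auto simp: p_def q_def)
  then obtain a where a: "a \<le> 2 * M" "dd m (G (min a M) (a - M)) \<le> R" by auto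
  define i j where "i = min a M" and "j = a - M"
  have ij: "i \<le> M" "j \<le> M" "i = M \<or> j = 0" "dd m (G i j) \<le> R"
    using a by (auto simp: i_def j_def)
  have "\<exists>i\<in>{0..2*M}. dd m (G (i - M) (min i M)) \<le> R"
  proof (rule path)
    show "G (i - M) (min i M) \<in> S" if "i \<le> 2 * M" for i using that by (intro G(1)) auto
    show "dd (G (i - M) (min i M)) (G (Suc i - M) (min (Suc i) M)) \<le> 1" if "i < 2 * M" for i
      using G(3)[of 0 i] G(2)[of "i - M" M] that by (cases "i < M") (auto simp: Suc_diff_le)
  qed (auto simp: p_def q_def)
  then obtain b where b: "b \<le> 2 * M" "dd m (G (b - M) (min b M)) \<le> R" by auto
  define i' j' where "i' = b - M" and "j' = min b M"
  have ij': "i' \<le> M" "j' \<le> M" "j' = M \<or> i' = 0" "dd m (G i' j') \<le> R"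
    using b by (auto simp: i'_def j'_def)
  have GS: "G i j \<in> S" "G i' j' \<in> S" "G i j' \<in> S" "G i' j \<in> S" using ij ij' G(1) by auto
  have close: "dd (G i j) (G i' j') \<le> 2 * R"
    using dd_triangle[of "G i j" m "G i' j'"] dd_sym[of m "G i j"] GS mS ij ij' by auto
  then have "\<kappa> * \<bar>real i - real i'\<bar> \<le> \<kappa> * Q"
    using G(4)[of i j i' j'] ij ij' Q by auto
  then have ii: "\<bar>real i - real i'\<bar> \<le> Q" using \<kappa> by simp
  consider "j = 0" "i' = 0" | "j = 0" "j' = M" | "i = M" "i' = 0" | "i = M" "j' = M"
    using ij(3) ij'(3) by auto
  then show False
  proof cases
    case 1
    then have "dd p (G i j) \<le> Q" using horiz[of 0 i 0] ij ii by (auto simp: p_def)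
    then show False using far(1)[OF GS(1) ij(4)] by simp
  next
    case 2
    \<comment> \<open>The second point is moved to the same \<open>i\<close> as the first one,
      because the lower bound for differences in \<open>j\<close> is available only there.\<close>
    have "dd (G i' M) (G i M) \<le> Q"
      using horiz[of i i' M] horiz[of i' i M] ij ij' ii dd_sym[of "G i M" "G i' M"] GS 2
      by (cases "i \<le> i'") auto
    then have "dd (G i 0) (G i M) \<le> 2 * R + Q"
      using close dd_triangle[of "G i 0" "G i' M" "G i M"] GS 2 by auto
    then show False using G(5)[of i 0 M] ij big Q R1 by auto
  next
    case 3
    then have "real M \<le> Q" using ii by auto
    then have "\<kappa> * M \<le> 2 * R" using Q \<kappa> by (metis mult_le_cancel_left_pos)
    then show False using big Q by auto
  next
    case 4
    then have "dd (G i' j') q \<le> Q" using horiz[of i' M M] ij' ii by (auto simp: q_def)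
    then show False using far(2)[OF GS(2) ij'(4)] by simp
  qed
qed

end

section \<open>Boundary disks\<close>

text \<open>The convex hull of the disk has a non-empty relative interior, and the direction space of its
  affine hull contains the complex line spanned by any derivative of the disk.\<close>

lemma affine_disk_in_frontier:
  fixes \<Omega> :: "(complex ^ 'n) set"
  assumes op: "open \<Omega>" and cvx: "convex \<Omega>"
    and \<phi>: "holo_map \<phi>" "\<phi> ` ball 0 1 \<subseteq> frontier \<Omega>" "\<not> (\<exists>c. \<forall>z\<in>ball 0 1. \<phi> z = c)"
  obtains \<beta> x0 v \<rho> where "v \<noteq> 0" "\<rho> > 0" "\<And>z. z \<in> \<Omega> \<Longrightarrow> inner \<beta> z < inner \<beta> x0"
    "clin \<beta> v = 0" "\<And>\<zeta>. cmod \<zeta> \<le> \<rho> \<Longrightarrow> x0 + \<zeta> *s v \<in> closure \<Omega>"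
proof -
  have fr: "frontier \<Omega> = closure \<Omega> - \<Omega>" using op by (simp add: frontier_def interior_open)
  then have y: "\<phi> 0 \<notin> \<Omega>" using \<phi>(2) by (auto simp: image_subset_iff)
  obtain \<beta> where \<beta>: "\<And>z. z \<in> \<Omega> \<Longrightarrow> inner \<beta> z < inner \<beta> (\<phi> 0)"
    using supporting_functional[OF op cvx y] by blast
  define c where "c = inner \<beta> (\<phi> 0)"
  have "closure \<Omega> \<subseteq> {z. inner \<beta> z \<le> c}"
    using \<beta> by (intro closure_minimal closed_halfspace_le) (auto simp: c_def less_imp_le)
  then have le: "inner \<beta> (\<phi> z) \<le> c" if "z \<in> ball 0 1" for z
    using \<phi>(2) fr that by blast
  \<comment> \<open>Exponentiating turns a maximum of the real part at the interior point 0 into a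
    maximum of the modulus.\<close>
  have "(\<lambda>z. exp (clin \<beta> (\<phi> z))) constant_on ball 0 1"
  proof (rule maximum_modulus_principle)
    show "(\<lambda>z. exp (clin \<beta> (\<phi> z))) holomorphic_on ball 0 1"
      using clin_holomorphic[OF \<phi>(1)] by (intro holomorphic_intros)
    show "cmod (exp (clin \<beta> (\<phi> z))) \<le> cmod (exp (clin \<beta> (\<phi> 0)))" if "z \<in> ball 0 1" for z
      using le[OF that] by (simp add: c_def)
  qed auto
  then obtain k where k: "\<And>z. z \<in> ball 0 1 \<Longrightarrow> exp (clin \<beta> (\<phi> z)) = k"
    unfolding constant_on_def by blast
  have const: "inner \<beta> (\<phi> z) = c" if "z \<in> ball 0 1" for z
  proof -
    have "cmod (exp (clin \<beta> (\<phi> z))) = cmod (exp (clin \<beta> (\<phi> 0)))"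
      using k[OF that] k[of 0] by simp
    then show ?thesis by (simp add: c_def)
  qed
  have "\<exists>z\<in>ball 0 1. \<exists>i. deriv (\<lambda>z. \<phi> z $ i) z \<noteq> 0"
  proof (rule ccontr)
    assume neg: "\<not> (\<exists>z\<in>ball 0 1. \<exists>i. deriv (\<lambda>z. \<phi> z $ i) z \<noteq> 0)"
    have "\<phi> z $ i = \<phi> 0 $ i" if "z \<in> ball 0 1" for z i
    proof -
      have "\<exists>c. \<forall>z\<in>ball 0 1. \<phi> z $ i = c"
      proof (rule has_field_derivative_zero_constant)
        fix z :: complex assume z: "z \<in> ball 0 1"
        have "((\<lambda>z. \<phi> z $ i) has_field_derivative deriv (\<lambda>z. \<phi> z $ i) z) (at z)"
          using \<phi>(1) z unfolding holo_map_def by (intro holomorphic_derivI[of _ "ball 0 1"]) auto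
        then have "((\<lambda>z. \<phi> z $ i) has_field_derivative 0) (at z)" using neg z by simp
        then show "((\<lambda>z. \<phi> z $ i) has_field_derivative 0) (at z within ball 0 1)"
          by (rule has_field_derivative_at_within)
      qed simp
      then show ?thesis using that by force
    qed
    then have "\<forall>z\<in>ball 0 1. \<phi> z = \<phi> 0" unfolding vec_eq_iff by blast
    then show False using \<phi>(3) by blast
  qed
  then obtain z0 i0 where z0: "z0 \<in> ball 0 1" "deriv (\<lambda>z. \<phi> z $ i0) z0 \<noteq> 0" by blast
  define v :: "complex ^ 'n" where "v = (\<chi> i. deriv (\<lambda>z. \<phi> z $ i) z0)"
  have "v \<noteq> 0" using z0(2) by (auto simp: v_def vec_eq_iff)
  define S where "S = convex hull (\<phi> ` ball 0 1)"
  have "S \<noteq> {}" "convex S" by (auto simp: S_def)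
  then have "rel_interior S \<noteq> {}" by (simp add: rel_interior_eq_empty)
  then obtain x0 e where x0: "x0 \<in> S" "e > 0" "cball x0 e \<inter> affine hull S \<subseteq> S"
    unfolding mem_rel_interior_cball[symmetric] by (metis all_not_in_conv mem_rel_interior_cball)
  have Scl: "S \<subseteq> closure \<Omega>"
    unfolding S_def using \<phi>(2) fr by (intro hull_minimal convex_closure cvx) auto
  have "S \<subseteq> {z. inner \<beta> z = c}"
    unfolding S_def using const by (intro hull_minimal convex_hyperplane) auto
  then have aff: "affine hull S \<subseteq> {z. inner \<beta> z = c}"
    by (intro hull_minimal affine_hyperplane)
  have \<phi>S: "\<phi> z \<in> affine hull S" if "z \<in> ball 0 1" for z
    unfolding S_def using that by (intro hull_inc) auto
  have line: "x0 + \<zeta> *s v \<in> affine hull S" for \<zeta>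
  proof (cases "\<zeta> = 0")
    case False
    \<comment> \<open>With \<open>k = n + 1\<close>, the vectors
      \<open>k * (\<phi> (z0 + \<zeta> / k) - \<phi> z0)\<close> tend to
      \<open>\<zeta> *s v\<close>. Added to \<open>x0\<close> they stay in the affine hull, which is
      closed.\<close>
    define h where "h n = \<zeta> * of_real (1 / (real n + 1))" for n
    have h0: "h \<longlonglongrightarrow> 0"
    proof -
      have "(\<lambda>n. \<zeta> * of_real (1 / (real n + 1))) \<longlonglongrightarrow> \<zeta> * of_real 0"
        using LIMSEQ_inverse_real_of_nat
        by (intro tendsto_intros) (simp add: divide_inverse add.commute)
      then show ?thesis by (simp flip: h_def del: of_real_divide)
    qed
    have hnz: "h n \<noteq> 0" for n
    proof -
      have "1 / (real n + 1) \<noteq> 0" by simp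
      then show ?thesis using False by (simp add: h_def del: of_real_divide)
    qed
    have hat: "filterlim h (at 0) sequentially"
      using h0 hnz by (simp add: filterlim_at)
    define X where "X n = x0 + (real n + 1) *\<^sub>R (\<phi> (z0 + h n) - \<phi> z0)" for n
    have "X \<longlonglongrightarrow> x0 + \<zeta> *s v"
    proof (rule vec_tendstoI)
      fix i
      have "((\<lambda>z. \<phi> z $ i) has_field_derivative v $ i) (at z0)"
        using \<phi>(1) z0(1) unfolding holo_map_def v_def
        by (simp, intro holomorphic_derivI[of _ "ball 0 1"]) auto
      then have "((\<lambda>k. (\<phi> (z0 + k) $ i - \<phi> z0 $ i) / k) \<longlongrightarrow> v $ i) (at 0)"
        by (simp add: DERIV_def)
      then have "(\<lambda>n. (\<phi> (z0 + h n) $ i - \<phi> z0 $ i) / h n) \<longlonglongrightarrow> v $ i"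
        using filterlim_compose hat by blast
      then have "(\<lambda>n. x0 $ i + \<zeta> * ((\<phi> (z0 + h n) $ i - \<phi> z0 $ i) / h n)) \<longlonglongrightarrow> x0 $ i + \<zeta> * v $ i"
        by (intro tendsto_intros)
      moreover have "\<zeta> * (a / h n) = of_real (real n + 1) * a" for n a
      proof -
        have "complex_of_real (real n + 1) \<noteq> 0"
          by (metis of_real_eq_0_iff add.commute of_nat_Suc of_nat_neq_0)
        then show ?thesis using False by (simp add: h_def field_simps)
      qed
      ultimately show "(\<lambda>n. X n $ i) \<longlonglongrightarrow> (x0 + \<zeta> *s v) $ i"
        by (simp only: X_def vector_add_component vector_scaleR_component vector_minus_component
            vector_smult_component scaleR_conv_of_real[where 'a = complex])
    qed
    moreover have "\<forall>\<^sub>F n in sequentially. X n \<in> affine hull S"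
    proof -
      have "(\<lambda>n. z0 + h n) \<longlonglongrightarrow> z0 + 0" using h0 by (intro tendsto_intros)
      then have "\<forall>\<^sub>F n in sequentially. z0 + h n \<in> ball 0 1"
        using z0(1) topological_tendstoD[of _ z0 sequentially "ball 0 1"] by simp
      then show ?thesis
      proof eventually_elim
        case (elim n)
        then show ?case
          unfolding X_def using x0(1) z0(1)
          by (intro mem_affine_3_minus affine_affine_hull \<phi>S hull_inc)
      qed
    qed
    ultimately show ?thesis by (intro Lim_in_closed_set[OF closed_affine_hull]) auto
  qed (use x0(1) in \<open>simp add: hull_inc\<close>)
  show ?thesis
  proof (rule that[of v "e / norm v" \<beta> x0])
    show "v \<noteq> 0" "e / norm v > 0" using \<open>v \<noteq> 0\<close> x0(2) by auto
    have x0c: "inner \<beta> x0 = c" using aff hull_inc[OF x0(1), of affine] by blast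
    then show "inner \<beta> z < inner \<beta> x0" if "z \<in> \<Omega>" for z using \<beta>[OF that] by (simp add: c_def)
    show "clin \<beta> v = 0"
    proof (rule clin_eq_0I)
      fix k
      have "inner \<beta> (x0 + k *s v) = c" using aff line by blast
      then show "inner \<beta> (k *s v) = 0" using x0c by (simp add: inner_right_distrib)
    qed
    show "x0 + \<zeta> *s v \<in> closure \<Omega>" if "cmod \<zeta> \<le> e / norm v" for \<zeta>
    proof -
      have "norm (\<zeta> *s v) \<le> e" using that \<open>v \<noteq> 0\<close> by (simp add: norm_vec_scale field_simps)
      then have "x0 + \<zeta> *s v \<in> cball x0 e" by (simp add: dist_norm)
      then show ?thesis using line x0(3) Scl by blast
    qed
  qed
qed

text \<open>C-properness speaks of lines in \<Omega>, while boundary disks give information on the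
  closure. Convex combinations of \<open>p\<close> with ever more remote points of the line, taken
  with small weight, converge to points of the parallel line through \<open>p\<close>.\<close>

lemma line_in_closure_imp_line_in:
  fixes \<Omega> :: "(complex ^ 'n) set"
  assumes op: "open \<Omega>" and cvx: "convex \<Omega>" and p: "p \<in> \<Omega>"
    and line: "\<And>\<zeta>. x0 + \<zeta> *s v \<in> closure \<Omega>"
  shows "p + \<zeta> *s v \<in> \<Omega>"
proof -
  \<comment> \<open>Twice the wanted displacement: the limit \<open>p + w\<close> lies only in the
    closure, and its midpoint with the interior point \<open>p\<close> lies in \<Omega>.\<close>
  define w where "w = (2 * \<zeta>) *s v"
  define X where "X n = (1 - 1 / (real n + 1)) *\<^sub>R p + (1 / (real n + 1)) *\<^sub>R (x0 + (of_real (real n + 1) * (2 * \<zeta>)) *s v)" for n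
  have X: "X n \<in> closure \<Omega>" for n
    unfolding X_def using p line closure_subset[of \<Omega>]
    by (intro convexD[OF convex_closure[OF cvx]]) auto
  have Xeq: "X n = (1 - 1 / (real n + 1)) *\<^sub>R p + (1 / (real n + 1)) *\<^sub>R x0 + w" for n
  proof -
    have "(1 / (real n + 1)) *\<^sub>R ((of_real (real n + 1) * (2 * \<zeta>)) *s v) = w"
    proof -
      have nz: "complex_of_real (real n + 1) \<noteq> 0"
        by (metis of_real_eq_0_iff add.commute of_nat_Suc of_nat_neq_0)
      show ?thesis
        unfolding w_def scaleR_eq_scale vector_smult_assoc using nz by (simp add: field_simps)
    qed
    then show ?thesis by (simp only: X_def scaleR_add_right add.assoc)
  qed
  have inv: "(\<lambda>n. 1 / (real n + 1)) \<longlonglongrightarrow> 0"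
    using LIMSEQ_inverse_real_of_nat by (simp add: divide_inverse add.commute)
  have "(\<lambda>n. (1 - 1 / (real n + 1)) *\<^sub>R p + (1 / (real n + 1)) *\<^sub>R x0 + w) \<longlonglongrightarrow> (1 - 0) *\<^sub>R p + 0 *\<^sub>R x0 + w"
    by (intro tendsto_intros inv)
  then have "X \<longlonglongrightarrow> p + w" by (simp flip: Xeq)
  then have "p + w \<in> closure \<Omega>" using X closed_sequentially[OF closed_closure] by blast
  then have "(p + w) - (1/2) *\<^sub>R ((p + w) - p) \<in> interior \<Omega>"
    using p op by (intro mem_interior_closure_convex_shrink[OF cvx]) (auto simp: interior_open)
  moreover have "(p + w) - (1/2) *\<^sub>R ((p + w) - p) = p + \<zeta> *s v"
    by (simp add: w_def scaleR_eq_scale vec_eq_iff algebra_simps)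
  ultimately have "p + \<zeta> *s v \<in> interior \<Omega>" by (simp only:)
  then show ?thesis using interior_subset by blast
qed

lemma artanh_le_1: "0 \<le> t \<Longrightarrow> t \<le> 1/2 \<Longrightarrow> artanh (t::real) \<le> 1"
proof -
  assume t: "0 \<le> t" "t \<le> 1/2"
  have "(1 + t) / (1 - t) \<le> 3" using t by (simp add: field_simps)
  also have "(3::real) \<le> exp 2" using exp_ge_add_one_self[of 2] by simp
  finally have "ln ((1 + t) / (1 - t)) \<le> 2" using t by (subst ln_le_iff_exp) auto
  then show ?thesis by (simp add: artanh_def)
qed

text \<open>A point of the complex line outside the closure fixes a real ray. The parameters of its
  points in the closure are bounded, by convexity, and form a closed set; rescaling by the largest
  one puts the end at \<open>r = 1\<close> and shrinks or stretches the disk radius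
  accordingly.\<close>

lemma maximal_affine_ray:
  fixes \<Omega> :: "(complex ^ 'n) set"
  assumes op: "open \<Omega>" and cvx: "convex \<Omega>" and nolines: "C_proper \<Omega>" and ne: "\<Omega> \<noteq> {}"
    and v: "v \<noteq> 0" and \<rho>: "\<rho> > 0" "\<And>\<zeta>. cmod \<zeta> \<le> \<rho> \<Longrightarrow> x0 + \<zeta> *s v \<in> closure \<Omega>"
  obtains \<omega> \<rho>' where "\<rho>' > 0" "\<And>\<zeta>. cmod \<zeta> \<le> \<rho>' \<Longrightarrow> x0 + \<zeta> *s (\<omega> *s v) \<in> closure \<Omega>"
    "x0 + \<omega> *s v \<in> closure \<Omega>" "\<And>r. r > 1 \<Longrightarrow> x0 + of_real r *s (\<omega> *s v) \<notin> closure \<Omega>"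
proof -
  obtain p where p: "p \<in> \<Omega>" using ne by blast
  obtain \<zeta> where \<zeta>: "x0 + \<zeta> *s v \<notin> closure \<Omega>"
    using line_in_closure_imp_line_in[OF op cvx p, of x0 v] nolines v unfolding C_proper_def by blast
  have \<zeta>0: "\<zeta> \<noteq> 0" using \<zeta> \<rho>(2)[of 0] \<rho>(1) by auto
  have ccl: "convex (closure \<Omega>)" by (rule convex_closure[OF cvx])
  define T where "T = {r. 0 \<le> r \<and> x0 + (of_real r * \<zeta>) *s v \<in> closure \<Omega>}"
  have T1: "r \<le> 1" if "r \<in> T" for r
  proof (rule ccontr)
    assume "\<not> r \<le> 1"
    then have r: "r > 1" by simp
    have "(1 - 1 / r) *\<^sub>R x0 + (1 / r) *\<^sub>R (x0 + (of_real r * \<zeta>) *s v) \<in> closure \<Omega>"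
      using that r \<rho>(2)[of 0] \<rho>(1) by (intro convexD[OF ccl]) (auto simp: T_def)
    also have "(1 - 1 / r) *\<^sub>R x0 + (1 / r) *\<^sub>R (x0 + (of_real r * \<zeta>) *s v) = x0 + \<zeta> *s v"
    proof -
      have "(1 / r) *\<^sub>R ((of_real r * \<zeta>) *s v) = \<zeta> *s v"
        using r by (simp add: scaleR_eq_scale)
      then show ?thesis by (simp add: algebra_simps)
    qed
    finally show False using \<zeta> by simp
  qed
  define r0 where "r0 = Sup T"
  have small: "\<rho> / cmod \<zeta> \<in> T"
    unfolding T_def using \<zeta>0 \<rho>(1) by (auto intro!: \<rho>(2) simp: norm_mult norm_divide)
  have bdd: "bdd_above T" using T1 by (intro bdd_aboveI[of _ 1])
  have cont: "continuous_on UNIV (\<lambda>r. x0 + (of_real r * \<zeta>) *s v)"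
    by (rule continuous_on_vec_lambda[of UNIV "\<lambda>i r. x0 $ i + (of_real r * \<zeta>) * v $ i",
          THEN continuous_on_eq]) (auto intro!: continuous_intros simp: vec_eq_iff)
  have "closed T"
  proof -
    have "closed ((\<lambda>r. x0 + (of_real r * \<zeta>) *s v) -` closure \<Omega>)"
      using cont by (intro closed_vimage) auto
    then have "closed ({0..} \<inter> (\<lambda>r. x0 + (of_real r * \<zeta>) *s v) -` closure \<Omega>)" by (intro closed_Int) auto
    moreover have "{0..} \<inter> (\<lambda>r. x0 + (of_real r * \<zeta>) *s v) -` closure \<Omega> = T" by (auto simp: T_def)
    ultimately show ?thesis by simp
  qed
  then have r0T: "r0 \<in> T" unfolding r0_def using small bdd by (intro closed_contains_Sup) auto
  have r0: "r0 > 0"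
    using cSup_upper[OF small bdd] \<rho>(1) \<zeta>0 unfolding r0_def
    by (meson divide_pos_pos less_le_trans zero_less_norm_iff)
  show ?thesis
  proof (rule that[of "\<rho> / (r0 * cmod \<zeta>)" "of_real r0 * \<zeta>"])
    show "\<rho> / (r0 * cmod \<zeta>) > 0" using \<rho>(1) r0 \<zeta>0 by simp
    show "x0 + \<xi> *s ((of_real r0 * \<zeta>) *s v) \<in> closure \<Omega>" if "cmod \<xi> \<le> \<rho> / (r0 * cmod \<zeta>)" for \<xi>
    proof -
      have "cmod (\<xi> * (of_real r0 * \<zeta>)) \<le> \<rho>"
        using that r0 \<zeta>0 by (simp add: norm_mult field_simps)
      from \<rho>(2)[OF this] show ?thesis by simp
    qed
    show "x0 + (of_real r0 * \<zeta>) *s v \<in> closure \<Omega>" using r0T by (simp add: T_def)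
    show "x0 + of_real r *s ((of_real r0 * \<zeta>) *s v) \<notin> closure \<Omega>" if "r > 1" for r
    proof
      assume "x0 + of_real r *s ((of_real r0 * \<zeta>) *s v) \<in> closure \<Omega>"
      then have "r * r0 \<in> T" using that r0 by (simp add: T_def mult.assoc)
      then have "r * r0 \<le> r0" unfolding r0_def using cSup_upper[OF _ bdd] by blast
      then show False using that r0 by simp
    qed
  qed
qed

text \<open>Coordinates near a boundary disk: \<open>h\<close> is the height above the supporting hyperplane at \<open>x0\<close>,
  and \<open>r = 1\<close> is the end of the maximal segment from \<open>x0\<close> in direction \<open>e\<close>.\<close>

locale boundary_disk = C_proper_convex \<Omega> for \<Omega> :: "(complex ^ 'n) set" +
  fixes x0 e p \<beta> :: "complex ^ 'n" and \<rho> \<tau> :: real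
  assumes \<rho>_pos: "\<rho> > 0" and \<tau>_pos: "\<tau> > 0"
    and disk: "\<And>\<zeta>. cmod \<zeta> \<le> \<rho> \<Longrightarrow> x0 + \<zeta> *s e \<in> closure \<Omega>"
    and end_in: "x0 + e \<in> closure \<Omega>"
    and beyond: "\<And>r. r > 1 \<Longrightarrow> x0 + of_real r *s e \<notin> closure \<Omega>"
    and ball_p: "ball p \<tau> \<subseteq> \<Omega>"
    and supp: "\<And>z. z \<in> \<Omega> \<Longrightarrow> inner \<beta> z < inner \<beta> x0"
    and tangent: "clin \<beta> e = 0"
begin

section \<open>Distance estimates in the coordinates \<open>h\<close> and \<open>r\<close>\<close>

definition Pt :: "real \<Rightarrow> real \<Rightarrow> complex ^ 'n" where
  "Pt h r = x0 + h *\<^sub>R (p - x0) + of_real r *s e"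

lemma p_in: "p \<in> \<Omega>" using ball_p \<tau>_pos by auto

lemma p_neq: "norm (p - x0) > 0"
  using supp[OF p_in] by auto

text \<open>The point is a convex combination with weight \<open>h\<close> on the ball around
  \<open>p\<close>, weight \<open>r\<close> on the end point \<open>x0 + e\<close> and weight
  \<open>1 - h - r\<close> on the boundary disk. Each weight scales the freedom that its set leaves:
  \<open>\<tau> * h\<close> in every direction, \<open>\<rho> * (1 - h - r)\<close> along
  \<open>e\<close>.\<close>

lemma Pt_nbhd:
  assumes "0 < h" "0 \<le> r" "h + r < 1" "cmod \<zeta> \<le> \<rho> * (1 - h - r)" "norm w < \<tau> * h"
  shows "Pt h r + \<zeta> *s e + w \<in> \<Omega>"
proof -
  \<comment> \<open>\<open>l\<close> is the share of the end point in the total weight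
    \<open>1 - h\<close> of the two boundary pieces; \<open>\<omega>\<close>, and \<open>c\<close>
    below, undo the scaling of \<open>\<zeta>\<close> and \<open>w\<close>.\<close>
  define l where "l = r / (1 - h)"
  define \<omega> where "\<omega> = \<zeta> / of_real (1 - h - r)"
  have h: "1 - h > 0" "1 - h - r > 0" using assms by auto
  have l: "0 \<le> l" "l \<le> 1" using assms by (auto simp: l_def divide_simps)
  have \<omega>: "cmod \<omega> \<le> \<rho>" using assms(4) h unfolding \<omega>_def norm_divide norm_of_real
    by (simp add: pos_divide_le_eq)
  define q where "q = l *\<^sub>R (x0 + e) + (1 - l) *\<^sub>R (x0 + \<omega> *s e)"
  have q: "q \<in> closure \<Omega>"
    unfolding q_def using l end_in disk[OF \<omega>] convex_closure[OF convex_Omega]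
    by (intro convexD) auto
  define c where "c = p + (1 / h) *\<^sub>R w"
  have "dist p c = norm w / h" using assms(1) by (simp add: c_def dist_norm)
  also have "\<dots> < \<tau>" using assms(1,5) by (simp add: pos_divide_less_eq)
  finally have "c \<in> ball p \<tau>" by simp
  then have c: "c \<in> interior \<Omega>" using ball_p open_Omega by (auto simp: interior_open)
  have "q - h *\<^sub>R (q - c) \<in> interior \<Omega>"
    using assms by (intro mem_interior_closure_convex_shrink[OF convex_Omega c q]) auto
  moreover have "q - h *\<^sub>R (q - c) = Pt h r + \<zeta> *s e + w"
  proof -
    have "q = x0 + (of_real l + of_real (1 - l) * \<omega>) *s e"
      by (simp add: q_def scaleR_eq_scale vec_eq_iff algebra_simps)
    moreover have "h *\<^sub>R c = h *\<^sub>R p + w" using assms(1) by (simp add: c_def scaleR_add_right)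
    ultimately have A: "q - h *\<^sub>R (q - c)
        = x0 + h *\<^sub>R (p - x0) + (of_real (1 - h) * (of_real l + of_real (1 - l) * \<omega>)) *s e + w"
      by (simp only: scaleR_diff_right) (simp add: scaleR_eq_scale vec_eq_iff algebra_simps)
    have B: "of_real (1 - h) * (of_real l + of_real (1 - l) * \<omega>) = of_real r + \<zeta>"
    proof -
      have 1: "(1 - h) * l = r" "(1 - h) * (1 - l) = 1 - h - r"
        using h by (simp_all add: l_def field_simps)
      have "of_real (1 - h) * (of_real l + of_real (1 - l) * \<omega>)
          = of_real ((1 - h) * l) + of_real ((1 - h) * (1 - l)) * \<omega>"
        by (simp add: algebra_simps)
      also have "\<dots> = of_real r + \<zeta>" unfolding 1 \<omega>_def using h by (simp del: of_real_diff)
      finally show ?thesis .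
    qed
    show ?thesis unfolding A B Pt_def by (simp add: vec_eq_iff algebra_simps)
  qed
  ultimately show ?thesis using interior_subset by auto
qed

lemma Pt_in:
  assumes "0 < h" "0 \<le> r" "h + r < 1"
  shows "Pt h r \<in> \<Omega>"
  using Pt_nbhd[OF assms, of 0 0] \<rho>_pos \<tau>_pos assms by simp

text \<open>The step is at most half the radius of the ball of radius \<open>\<tau> * h\<close>, and
  \<open>artanh (1/2) \<le> 1\<close>.\<close>

lemma d_vertical_le:
  assumes "0 < h" "0 \<le> r" "h + r < 1" "2 * \<bar>h' - h\<bar> * norm (p - x0) \<le> \<tau> * h"
  shows "d (Pt h r) (Pt h' r) \<le> 1"
proof -
  have "ball (Pt h r) (\<tau> * h) \<subseteq> \<Omega>"
  proof
    fix y assume "y \<in> ball (Pt h r) (\<tau> * h)"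
    then have "norm (y - Pt h r) < \<tau> * h" by (simp add: dist_norm norm_minus_commute)
    from Pt_nbhd[OF assms(1-3) _ this, of 0] show "y \<in> \<Omega>" using \<rho>_pos assms by simp
  qed
  moreover have "dist (Pt h r) (Pt h' r) = \<bar>h' - h\<bar> * norm (p - x0)"
  proof -
    have "Pt h' r - Pt h r = (h' - h) *\<^sub>R (p - x0)" by (simp add: Pt_def algebra_simps)
    then show ?thesis by (metis dist_norm norm_minus_commute norm_scaleR)
  qed
  moreover have th: "\<tau> * h > 0" using \<tau>_pos assms by simp
  moreover have "\<bar>h' - h\<bar> * norm (p - x0) < \<tau> * h" using assms(4) th by linarith
  ultimately have "disc_link \<Omega> (Pt h r) (Pt h' r) (artanh (\<bar>h' - h\<bar> * norm (p - x0) / (\<tau> * h)))"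
    using disc_link_ball by metis
  moreover have "artanh (\<bar>h' - h\<bar> * norm (p - x0) / (\<tau> * h)) \<le> 1"
    using th assms(4) by (intro artanh_le_1) (auto simp: pos_divide_le_eq)
  ultimately show ?thesis using kobayashi_dist_le_chain[OF disc_chain_link] by fastforce
qed

lemma d_horizontal_le:
  assumes "0 < h" "0 \<le> r" "h + r < 1" "2 * \<bar>r' - r\<bar> \<le> \<rho> * (1 - h - r)"
  shows "d (Pt h r) (Pt h r') \<le> 1"
proof -
  define s where "s = \<rho> * (1 - h - r)"
  have s: "s > 0" using assms \<rho>_pos by (simp add: s_def)
  let ?t = "of_real ((r' - r) / s) :: complex"
  have t: "cmod ?t \<le> 1/2" using assms(4) s by (simp add: norm_of_real s_def[symmetric] divide_simps del: of_real_divide)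
  have "Pt h r + z *s (of_real s *s e) \<in> \<Omega>" if "cmod z < 1" for z
  proof -
    have "cmod (z * of_real s) \<le> s"
      using that s by (simp add: norm_mult mult_left_le_one_le)
    then have "Pt h r + (z * of_real s) *s e + 0 \<in> \<Omega>"
      using assms \<tau>_pos by (intro Pt_nbhd) (auto simp: s_def)
    then show ?thesis by simp
  qed
  from disc_link_affine[OF this, of ?t]
  have "disc_link \<Omega> (Pt h r) (Pt h r + ?t *s (of_real s *s e)) (artanh (cmod ?t))"
    using t by simp
  moreover have "Pt h r + ?t *s (of_real s *s e) = Pt h r'"
  proof -
    have t': "?t * of_real s = of_real (r' - r)" using s by (simp flip: of_real_mult)
    show ?thesis
      unfolding Pt_def vector_smult_assoc t' by (simp add: vec_eq_iff algebra_simps)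
  qed
  moreover have "artanh (cmod ?t) \<le> 1" using t by (intro artanh_le_1) auto
  ultimately show ?thesis using kobayashi_dist_le_chain[OF disc_chain_link] by fastforce
qed

text \<open>\<open>\<beta>\<close> vanishes on \<open>e\<close>, so the height is \<open>h\<close>
  times that of \<open>p\<close>, whatever \<open>r\<close> is. This is why \<open>r\<close> and
  \<open>r'\<close> may differ.\<close>

lemma d_vertical_ge:
  assumes "Pt h r \<in> \<Omega>" "Pt h' r' \<in> \<Omega>" "h > 0" "h' > 0"
  shows "ln (h' / h) / 2 \<le> d (Pt h r) (Pt h' r')"
proof -
  have *: "inner \<beta> x0 - inner \<beta> (Pt h r) = h * (inner \<beta> x0 - inner \<beta> p)" for h r
  proof -
    have "inner \<beta> (of_real r *s e) = 0" using tangent by (simp only: inner_scale) simp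
    then show ?thesis by (simp add: Pt_def inner_right_distrib inner_diff_right algebra_simps)
  qed
  have "inner \<beta> x0 - inner \<beta> p > 0" using supp[OF p_in] by simp
  then show ?thesis
    using d_ln_half_space[OF assms(1,2) supp] unfolding * by simp
qed

text \<open>At fixed \<open>h\<close>, the distance to a supporting hyperplane at
  \<open>Pt h (1 + \<eta>)\<close> is proportional to \<open>1 + \<eta> - r\<close>. Its slope along
  \<open>p - x0\<close> is unknown, so both points must have the same \<open>h\<close>.\<close>

lemma d_horizontal_ge:
  assumes "Pt h r \<in> \<Omega>" "Pt h r' \<in> \<Omega>" "0 \<le> r" "0 \<le> r'" "r \<le> 1" "r' \<le> 1" "\<eta> > 0" "Pt h (1 + \<eta>) \<notin> \<Omega>"
  shows "ln ((1 + \<eta> - r') / (1 + \<eta> - r)) / 2 \<le> d (Pt h r) (Pt h r')"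
proof -
  obtain \<gamma> where \<gamma>: "\<And>z. z \<in> \<Omega> \<Longrightarrow> inner \<gamma> z < inner \<gamma> (Pt h (1 + \<eta>))"
    using supporting_functional[OF open_Omega convex_Omega assms(8)] by blast
  have *: "inner \<gamma> (Pt h (1 + \<eta>)) - inner \<gamma> (Pt h r) = (1 + \<eta> - r) * inner \<gamma> e" for r
  proof -
    have "inner \<gamma> (of_real r *s e) = r * inner \<gamma> e" for r
      by (simp flip: scaleR_eq_scale)
    then show ?thesis by (simp add: Pt_def inner_right_distrib algebra_simps del: of_real_add)
  qed
  have "(1 + \<eta> - r) * inner \<gamma> e > 0" using *[of r] \<gamma>[OF assms(1)] by simp
  then have "inner \<gamma> e > 0" using assms by (simp add: zero_less_mult_iff)
  then show ?thesis
    using d_ln_half_space[OF assms(1,2) \<gamma>] unfolding * by simp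
qed

text \<open>The point at parameter \<open>1 + \<eta>\<close> lies outside the closure at height 0,
  and this is an open condition. How small \<open>h\<close> must be depends on
  \<open>\<eta>\<close>.\<close>

lemma eventually_outside:
  assumes "\<eta> > 0"
  obtains h0 where "h0 > 0" "\<And>h. 0 < h \<Longrightarrow> h \<le> h0 \<Longrightarrow> Pt h (1 + \<eta>) \<notin> \<Omega>"
proof -
  let ?y = "x0 + of_real (1 + \<eta>) *s e"
  have "?y \<in> - closure \<Omega>" using beyond[of "1 + \<eta>"] assms by simp
  then obtain \<epsilon> where \<epsilon>: "\<epsilon> > 0" "ball ?y \<epsilon> \<subseteq> - closure \<Omega>"
    by (meson closed_closure open_Compl openE)
  show ?thesis
  proof (rule that[of "\<epsilon> / (2 * norm (p - x0))"])
    show "\<epsilon> / (2 * norm (p - x0)) > 0" using \<epsilon>(1) p_neq by simp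
    show "Pt h (1 + \<eta>) \<notin> \<Omega>" if "0 < h" "h \<le> \<epsilon> / (2 * norm (p - x0))" for h
    proof -
      have "2 * (h * norm (p - x0)) \<le> \<epsilon>" using that p_neq by (simp add: field_simps)
      then have "h * norm (p - x0) < \<epsilon>" using \<epsilon>(1) by linarith
      then have "Pt h (1 + \<eta>) \<in> ball ?y \<epsilon>"
        using that(1) by (simp add: Pt_def dist_norm norm_minus_commute del: of_real_add)
      then show ?thesis using \<epsilon>(2) closure_subset[of \<Omega>] by blast
    qed
  qed
qed

text \<open>Heights and distances \<open>1 - r\<close> to the end decrease geometrically. The
  admissible step is proportional to \<open>h\<close> in one direction and, at these small heights,
  to \<open>1 - r\<close> in the other, so one \<open>\<kappa>\<close> serves all
  \<open>M\<close>.\<close>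

lemma square_grid_exists:
  assumes \<kappa>: "\<kappa> > 0" "4 * \<kappa> \<le> \<rho>" "4 * \<kappa> * norm (p - x0) \<le> \<tau>"
  shows "\<exists>G. square_grid d \<Omega> (\<kappa> / 2) M G"
proof -
  \<comment> \<open>The value of \<open>1 - r\<close> in the last column; an uncertainty of this
    size about the end of a row at most doubles any \<open>1 - r j\<close>.\<close>
  define \<eta> where "\<eta> = exp (- \<kappa> * M)"
  have \<eta>: "\<eta> > 0" by (simp add: \<eta>_def)
  obtain h1 where h1: "h1 > 0" "\<And>h. 0 < h \<Longrightarrow> h \<le> h1 \<Longrightarrow> Pt h (1 + \<eta>) \<notin> \<Omega>"
    using eventually_outside[OF \<eta>] by blast
  \<comment> \<open>\<open>\<eta> / 2\<close> makes every height at most half of every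
    \<open>1 - r j\<close>, which gives \<open>gap\<close>; \<open>h1\<close> lets
    \<open>d_horizontal_ge\<close> be applied in all rows.\<close>
  define h0 where "h0 = min h1 (\<eta> / 2)"
  define h where "h i = h0 * exp (- 2 * \<kappa> * real i)" for i :: nat
  define r where "r j = 1 - exp (- \<kappa> * real j)" for j :: nat
  define G where "G i j = Pt (h i) (r j)" for i j
  have h0: "h0 > 0" using h1 \<eta> by (simp add: h0_def)
  have h: "0 < h i" "h i \<le> h0" for i
    using h0 \<kappa>(1) by (auto simp: h_def mult_left_le)
  have rb: "0 \<le> r j" "r j \<le> 1" for j using \<kappa>(1) by (auto simp: r_def)
  have \<eta>j: "\<eta> \<le> exp (- \<kappa> * real j)" if "j \<le> M" for j
    using that \<kappa>(1) by (simp add: \<eta>_def)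
  have gap: "1 - h i - r j \<ge> exp (- \<kappa> * real j) / 2" if "j \<le> M" for i j
    using h(2)[of i] \<eta>j[OF that] by (simp add: h0_def r_def)
  have lt1: "h i + r j < 1" if "j \<le> M" for i j
    using gap[OF that, of i] exp_gt_zero[of "- \<kappa> * real j"] by linarith
  have G: "G i j \<in> \<Omega>" if "j \<le> M" for i j
    unfolding G_def by (rule Pt_in[OF h(1) rb(1) lt1[OF that]])
  have exp1: "1 - exp (- x) \<le> x" "0 \<le> 1 - exp (- x)" if "x \<ge> 0" for x :: real
    using that exp_ge_add_one_self[of "- x"] by auto
  have V: "d (G i j) (G (Suc i) j) \<le> 1" if "j \<le> M" for i j
    unfolding G_def
  proof (rule d_vertical_le[OF h(1) rb(1) lt1[OF that]])
    have "h (Suc i) - h i = - (h i * (1 - exp (- (2 * \<kappa>))))"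
      by (simp add: h_def algebra_simps flip: exp_add)
    then have "\<bar>h (Suc i) - h i\<bar> = h i * (1 - exp (- (2 * \<kappa>)))"
      using h(1)[of i] exp1(2)[of "2 * \<kappa>"] \<kappa>(1) by simp
    also have "\<dots> \<le> h i * (2 * \<kappa>)"
      using h(1)[of i] exp1(1)[of "2 * \<kappa>"] \<kappa>(1) by (intro mult_left_mono) auto
    finally have "2 * \<bar>h (Suc i) - h i\<bar> * norm (p - x0) \<le> (4 * \<kappa> * norm (p - x0)) * h i"
      using mult_right_mono[of _ _ "2 * norm (p - x0)"] by (fastforce simp: mult_ac)
    also have "\<dots> \<le> \<tau> * h i" using \<kappa>(3) h(1)[of i] by (intro mult_right_mono) auto
    finally show "2 * \<bar>h (Suc i) - h i\<bar> * norm (p - x0) \<le> \<tau> * h i" .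
  qed
  have H: "d (G i j) (G i (Suc j)) \<le> 1" if "j \<le> M" for i j
    unfolding G_def
  proof (rule d_horizontal_le[OF h(1) rb(1) lt1[OF that]])
    have "r (Suc j) - r j = exp (- \<kappa> * real j) * (1 - exp (- \<kappa>))"
      by (simp add: r_def algebra_simps flip: exp_add)
    then have "\<bar>r (Suc j) - r j\<bar> = exp (- \<kappa> * real j) * (1 - exp (- \<kappa>))"
      using exp1(2)[of \<kappa>] \<kappa>(1) by simp
    also have "\<dots> \<le> exp (- \<kappa> * real j) * \<kappa>"
      using exp1(1)[of \<kappa>] \<kappa>(1) by (intro mult_left_mono) auto
    finally have "2 * \<bar>r (Suc j) - r j\<bar> \<le> (4 * \<kappa>) * (exp (- \<kappa> * real j) / 2)"
      by (simp add: mult.commute)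
    also have "\<dots> \<le> \<rho> * (1 - h i - r j)"
      using \<kappa> \<rho>_pos by (intro mult_mono gap that) auto
    finally show "2 * \<bar>r (Suc j) - r j\<bar> \<le> \<rho> * (1 - h i - r j)" .
  qed
  have V': "\<kappa> * (real i - real i') \<le> d (G i j) (G i' j')" if "j \<le> M" "j' \<le> M" for i i' j j'
  proof -
    have "h i' / h i = exp (2 * \<kappa> * (real i - real i'))"
      using h0 by (simp add: h_def field_simps flip: exp_add)
    moreover have "ln (h i' / h i) / 2 \<le> d (G i j) (G i' j')"
      using G[OF that(1)] G[OF that(2)] h(1) unfolding G_def by (intro d_vertical_ge)
    ultimately show ?thesis by simp
  qed
  have H': "\<kappa> / 2 * (real j' - real j) - 1 \<le> d (G i j) (G i j')" if "j \<le> M" "j' \<le> M" for i j j'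
  proof -
    define A B where "A = exp (- \<kappa> * real j)" and "B = exp (- \<kappa> * real j')"
    have AB: "A > 0" "B > 0" "\<eta> \<le> A" "\<eta> \<le> B" using \<eta>j that by (auto simp: A_def B_def)
    have "Pt (h i) (1 + \<eta>) \<notin> \<Omega>" using h[of i] by (intro h1(2)) (auto simp: h0_def)
    from d_horizontal_ge[OF G[OF that(2), unfolded G_def] G[OF that(1), unfolded G_def]
      rb(1) rb(1) rb(2) rb(2) \<eta> this]
    have "ln ((\<eta> + A) / (\<eta> + B)) / 2 \<le> d (G i j) (G i j')"
      by (simp add: G_def r_def A_def B_def kobayashi_dist_sym[of \<Omega> "Pt (h i) (1 - exp (- (\<kappa> * real j)))"])
    \<comment> \<open>\<open>\<eta> \<le> B\<close> gives \<open>\<eta> + B \<le> 2 * B\<close>.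
      This factor is the origin of the \<open>- 1\<close> in \<open>square_grid\<close>.\<close>
    moreover have "A / (2 * B) \<le> (\<eta> + A) / (\<eta> + B)"
      using AB \<eta> by (intro frac_le) auto
    then have "ln (A / (2 * B)) \<le> ln ((\<eta> + A) / (\<eta> + B))"
      using AB \<eta> by (subst ln_le_cancel_iff) (auto intro!: divide_pos_pos add_pos_pos)
    moreover have "ln (A / (2 * B)) = \<kappa> * (real j' - real j) - ln 2"
      using AB by (simp add: ln_div ln_mult) (simp add: A_def B_def algebra_simps)
    moreover have "ln 2 \<le> (1::real)" using ln_le_minus_one[of 2] by simp
    ultimately show ?thesis by linarith
  qed
  have "square_grid d \<Omega> (\<kappa> / 2) M G"
    unfolding square_grid_def
  proof (intro conjI allI impI)
    fix i j i' j' :: nat assume j: "j \<le> M" "j' \<le> M"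
    have "0 \<le> \<kappa> / 2 * \<bar>real i - real i'\<bar>" using \<kappa>(1) by simp
    then have "\<kappa> / 2 * \<bar>real i - real i'\<bar> \<le> \<kappa> * \<bar>real i - real i'\<bar>" by simp
    also have "\<dots> \<le> d (G i j) (G i' j')"
      using V'[OF j, of i i'] V'[OF j(2,1), of i' i] kobayashi_dist_sym[of \<Omega> "G i j" "G i' j'"]
      by (simp add: abs_if algebra_simps)
    finally show "\<kappa> / 2 * \<bar>real i - real i'\<bar> \<le> d (G i j) (G i' j')" .
    show "\<kappa> / 2 * \<bar>real j - real j'\<bar> - 1 \<le> d (G i j) (G i j')"
      using H'[OF j, of i] H'[OF j(2,1), of i] kobayashi_dist_sym[of \<Omega> "G i j" "G i j'"]
      by (simp add: abs_if)
  qed (use G V H in auto)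
  then show ?thesis by blast
qed

end

theorem theorem1p6:
  fixes \<Omega> :: "(complex ^ 'n) set"
  assumes "open \<Omega>" and "convex \<Omega>" and "C_proper \<Omega>"
    and "gromov_hyperbolic (kobayashi_dist \<Omega>) \<Omega>"
  shows "\<not> (\<exists>\<phi>. holo_map \<phi> \<and> \<phi> ` ball 0 1 \<subseteq> frontier \<Omega> \<and>
              \<not> (\<exists>c. \<forall>z\<in>ball 0 1. \<phi> z = c))"
proof
  assume "\<exists>\<phi>. holo_map \<phi> \<and> \<phi> ` ball 0 1 \<subseteq> frontier \<Omega> \<and> \<not> (\<exists>c. \<forall>z\<in>ball 0 1. \<phi> z = c)"
  then obtain \<phi> where \<phi>: "holo_map \<phi>" "\<phi> ` ball 0 1 \<subseteq> frontier \<Omega>" "\<not> (\<exists>c. \<forall>z\<in>ball 0 1. \<phi> z = c)"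
    by blast
  interpret C_proper_convex \<Omega> using assms by unfold_locales
  have "\<Omega> \<noteq> {}" using \<phi>(2) by auto
  then obtain p where p: "p \<in> \<Omega>" by blast
  then obtain \<tau> where \<tau>: "\<tau> > 0" "ball p \<tau> \<subseteq> \<Omega>" using open_Omega by (meson openE)
  obtain \<beta> x0 v \<rho>0 where v: "v \<noteq> 0" "\<rho>0 > 0" "\<And>z. z \<in> \<Omega> \<Longrightarrow> inner \<beta> z < inner \<beta> x0"
    "clin \<beta> v = 0" "\<And>\<zeta>. cmod \<zeta> \<le> \<rho>0 \<Longrightarrow> x0 + \<zeta> *s v \<in> closure \<Omega>"
    by (rule affine_disk_in_frontier[OF assms(1,2) \<phi>]) (rule that)
  obtain \<omega> \<rho> where \<rho>: "\<rho> > 0" "\<And>\<zeta>. cmod \<zeta> \<le> \<rho> \<Longrightarrow> x0 + \<zeta> *s (\<omega> *s v) \<in> closure \<Omega>"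
    "x0 + \<omega> *s v \<in> closure \<Omega>" "\<And>r. r > 1 \<Longrightarrow> x0 + of_real r *s (\<omega> *s v) \<notin> closure \<Omega>"
    by (rule maximal_affine_ray[OF assms(1-3) \<open>\<Omega> \<noteq> {}\<close> v(1,2,5)]) (assumption | rule that)+
  interpret boundary_disk \<Omega> x0 "\<omega> *s v" p \<beta> \<rho> \<tau>
    by unfold_locales (use \<rho> \<tau> v in \<open>auto simp: clin_scale simp del: vector_smult_assoc\<close>)
  obtain \<delta> where \<delta>: "\<delta> \<ge> 0" "\<And>\<sigma>1 a1 b1 \<sigma>2 a2 b2 \<sigma>3 a3 b3.
     geodesic_seg d \<Omega> \<sigma>1 a1 b1 \<Longrightarrow> geodesic_seg d \<Omega> \<sigma>2 a2 b2 \<Longrightarrow> geodesic_seg d \<Omega> \<sigma>3 a3 b3 \<Longrightarrow>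
     \<sigma>1 b1 = \<sigma>2 a2 \<Longrightarrow> \<sigma>2 b2 = \<sigma>3 a3 \<Longrightarrow> \<sigma>3 b3 = \<sigma>1 a1 \<Longrightarrow>
       near d \<delta> (\<sigma>1 ` {a1..b1}) (\<sigma>2 ` {a2..b2} \<union> \<sigma>3 ` {a3..b3})"
    using assms(4) unfolding gromov_hyperbolic_def by blast
  interpret thin_geodesic_space d \<Omega> \<delta>
  proof
    show "\<exists>A. geodesic_set d \<Omega> x y A" if "x \<in> \<Omega>" "y \<in> \<Omega>" for x y
      using C_proper_convex.geodesic_exists[OF C_proper_convex_axioms that]
      unfolding geodesic_set_def by metis
    show "near d \<delta> A (B \<union> C)"
      if "geodesic_set d \<Omega> x y A" "geodesic_set d \<Omega> y z B" "geodesic_set d \<Omega> z x C" for x y z A B C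
      using that unfolding geodesic_set_def by (elim exE conjE) (metis \<delta>(2))
  qed (use \<delta>(1) d_triangle kobayashi_dist_sym in auto)
  \<comment> \<open>The largest step that \<open>square_grid_exists\<close> admits; it depends on
    \<open>\<rho>\<close>, \<open>\<tau>\<close> and \<open>p - x0\<close>, so the same
    \<open>\<kappa> / 2\<close> works for grids of every size.\<close>
  define \<kappa> where "\<kappa> = min (\<rho> / 4) (\<tau> / (4 * norm (p - x0)))"
  have \<kappa>: "\<kappa> > 0" "4 * \<kappa> \<le> \<rho>" "4 * \<kappa> * norm (p - x0) \<le> \<tau>"
    using \<rho>_pos \<tau>_pos p_neq by (auto simp: \<kappa>_def min_def field_simps)
  show False
    by (rule no_square_grids[of "\<kappa> / 2"]) (use \<kappa> square_grid_exists in auto)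
qed

end
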